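(* Let $n\ge 1$ and $\mathbf{d}=(2,2,\ldots,2)$ ($n$ entries, i.e. $d_1=\cdots=d_n=2$). Then $$ \mathcal{PI}_{\mathbf{d}}(z)=\sum_{k=1}^n \frac{(-1)^{n-k}}{(n-k)!\,(k-1)!}\,\frac{d^{k-1}}{dz^{k-1}}\left(\sum_{i=0}^{n-k}\binom{n-k}{i}\frac{(n)_i\,(n)_{n-k-i}\,(1-z)\,z^{2n-k-i-1}}{(1-z)^{n+i}(1-z^2)^{2n-k-i}}\right), $$ $$ \mathcal{PS}_{\mathbf{d}}(z)=\sum_{k=1}^n \frac{(-1)^{n-k}}{(n-k)!\,(k-1)!}\,\frac{d^{k-1}}{dz^{k-1}}\left(\sum_{i=0}^{n-k}\binom{n-k}{i}\frac{(n)_i\,(n)_{n-k-i}\,z^{2n-k-i-1}}{(1-z)^{n+i}(1-z^2)^{2n-k-i}}\right), $$ where $(n)_m:=n(n+1)\cdots(n+m-1)$, $(n)_0:=1$.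
   Context: Let $\mathbb{K}$ be a field of characteristic $0$. For a tuple $\mathbf{d}=(d_1,\ldots,d_s)$ of nonnegative integers let $\mathbb{K}[X_{\mathbf{d}}]$ be the polynomial algebra in the variables $x_i^{(k)}$, $1\le k\le s$, $0\le i\le d_k$. Define $\mathbb{K}$-linear derivations of $\mathbb{K}[X_{\mathbf{d}}]$ by $$\mathcal{D}_{\mathbf{d}}(x_i^{(k)})=i\,x_{i-1}^{(k)},\qquad \mathcal{D}^*_{\mathbf{d}}(x_i^{(k)})=(d_k-i)\,x_{i+1}^{(k)}$$ (with $\mathcal{D}_{\mathbf{d}}(x_0^{(k)})=0$ and $\mathcal{D}^*_{\mathbf{d}}(x_{d_k}^{(k)})=0$). Put $\mathcal{I}_{\mathbf{d}}=\{v : \mathcal{D}_{\mathbf{d}}(v)=\mathcal{D}^*_{\mathbf{d}}(v)=0\}$ and $\mathcal{S}_{\mathbf{d}}=\ker\mathcal{D}_{\mathbf{d}}=\{v : \mathcal{D}_{\mathbf{d}}(v)=0\}$, graded by total degree, with homogeneous components $(\cdot)_m$. Their Poincaré series are $$\mathcal{PI}_{\mathbf{d}}(z)=\sum_{m\ge0}\dim(\mathcal{I}_{\mathbf{d}})_m z^m,\qquad \mathcal{PS}_{\mathbf{d}}(z)=\sum_{m\ge0}\dim(\mathcal{S}_{\mathbf{d}})_m z^m.$$ Rational functions are identified with their power series expansions at $z=0$. *)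

theory Defs
  imports
    "HOL-Library.Poly_Mapping"
    "HOL-Computational_Algebra.Formal_Power_Series"
begin

(* The variable x_i^(k) is the pair (k, i). The index k is 0-based: it runs over k < length d,
   so the paper's x_i^(k) is (k - 1, i). A power product is a finitely supported exponent
   function, and the product of two elements of 'k mpol is the convolution product. *)

type_synonym var = "nat \<times> nat"
type_synonym 'k mpol = "(var \<Rightarrow>\<^sub>0 nat) \<Rightarrow>\<^sub>0 'k"

definition X :: "var \<Rightarrow> 'k::comm_ring_1 mpol" where
  "X v = Poly_Mapping.single (Poly_Mapping.single v 1) 1"

definition smult_mpol :: "'k::comm_ring_1 \<Rightarrow> 'k mpol \<Rightarrow> 'k mpol" where
  "smult_mpol c p = Poly_Mapping.single 0 c * p"

definition mdeg :: "(var \<Rightarrow>\<^sub>0 nat) \<Rightarrow> nat" where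
  "mdeg m = (\<Sum>v\<in>Poly_Mapping.keys m. Poly_Mapping.lookup m v)"

definition vars_of :: "nat list \<Rightarrow> var set" where
  "vars_of d = {(k, i). k < length d \<and> i \<le> d ! k}"

definition poly_alg :: "nat list \<Rightarrow> 'k::comm_ring_1 mpol set" where
  "poly_alg d = {p. \<forall>m\<in>Poly_Mapping.keys p. Poly_Mapping.keys m \<subseteq> vars_of d}"

definition homog_part :: "nat \<Rightarrow> 'k::comm_ring_1 mpol set \<Rightarrow> 'k mpol set" where
  "homog_part n V = {p \<in> V. \<forall>m\<in>Poly_Mapping.keys p. mdeg m = n}"

(* The derivation x_v |-> f v, i.e. the sum over v of f v times the partial derivative by x_v;
   see derivation_of_add, derivation_of_smult, derivation_of_mult, derivation_of_X. *)

definition mono_deriv :: "(var \<Rightarrow> 'k::comm_ring_1 mpol) \<Rightarrow> (var \<Rightarrow>\<^sub>0 nat) \<Rightarrow> 'k mpol" where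
  "mono_deriv f m = (\<Sum>v\<in>Poly_Mapping.keys m.
     of_nat (Poly_Mapping.lookup m v) * Poly_Mapping.single (m - Poly_Mapping.single v 1) 1 * f v)"

definition derivation_of :: "(var \<Rightarrow> 'k::comm_ring_1 mpol) \<Rightarrow> 'k mpol \<Rightarrow> 'k mpol" where
  "derivation_of f p =
     (\<Sum>m\<in>Poly_Mapping.keys p. smult_mpol (Poly_Mapping.lookup p m) (mono_deriv f m))"

(* For i = 0 the first coefficient vanishes, for i = d ! k the second one does, so the junk
   variables (k, 0 - 1) = (k, 0) and (k, d ! k + 1) never contribute.
   Only the restrictions to poly_alg d matter. *)

definition D :: "'k::comm_ring_1 mpol \<Rightarrow> 'k mpol" where
  "D = derivation_of (\<lambda>(k, i). of_nat i * X (k, i - 1))"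

definition Dstar :: "nat list \<Rightarrow> 'k::comm_ring_1 mpol \<Rightarrow> 'k mpol" where
  "Dstar d = derivation_of (\<lambda>(k, i). of_nat (d ! k - i) * X (k, i + 1))"

definition invariants :: "nat list \<Rightarrow> 'k::comm_ring_1 mpol set" where
  "invariants d = {v \<in> poly_alg d. D v = 0 \<and> Dstar d v = 0}"

definition semi_invariants :: "nat list \<Rightarrow> 'k::comm_ring_1 mpol set" where
  "semi_invariants d = {v \<in> poly_alg d. D v = 0}"

(* A power series over the rationals, whatever the ground field is. *)

definition poincare_series :: "'k::field_char_0 mpol set \<Rightarrow> rat fps" where
  "poincare_series V = Abs_fps (\<lambda>m. of_nat (vector_space.dim smult_mpol (homog_part m V)))"

lemma vector_space_smult_mpol: "vector_space (smult_mpol :: 'k::field \<Rightarrow> _)"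
  by standard (simp_all add: smult_mpol_def distrib_left distrib_right single_add mult_single
      mult.assoc [symmetric])

lemma mpol_induct:
  fixes p :: "'k::comm_ring_1 mpol"
  assumes "P 0" "\<And>m c. P (Poly_Mapping.single m c)" "\<And>p q. P p \<Longrightarrow> P q \<Longrightarrow> P (p + q)"
  shows "P p"
proof -
  have "p = (\<Sum>m\<in>Poly_Mapping.keys p. Poly_Mapping.single m (Poly_Mapping.lookup p m))"
    by (intro poly_mapping_eqI)
       (auto simp: lookup_sum lookup_single when_def in_keys_iff)
  moreover have "P (\<Sum>m\<in>A. Poly_Mapping.single m (Poly_Mapping.lookup p m))" if "finite A" for A
    using that by induction (simp_all add: assms)
  ultimately show ?thesis
    using finite_keys by metis
qed

lemma lookup_smult_mpol:
  "Poly_Mapping.lookup (smult_mpol c p) m = c * Poly_Mapping.lookup p m"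
  by (induction p rule: mpol_induct)
     (simp_all add: smult_mpol_def mult_single lookup_single lookup_add distrib_left when_def)

lemma derivation_of_superset:
  assumes "finite A" "Poly_Mapping.keys p \<subseteq> A"
  shows "derivation_of f p =
    (\<Sum>m\<in>A. smult_mpol (Poly_Mapping.lookup p m) (mono_deriv f m))"
  unfolding derivation_of_def
  by (rule sum.mono_neutral_left [OF assms])
     (auto simp: smult_mpol_def in_keys_iff)

lemma derivation_of_add: "derivation_of f (p + q) = derivation_of f p + derivation_of f q"
proof -
  let ?A = "Poly_Mapping.keys p \<union> Poly_Mapping.keys q"
  have "finite ?A" "Poly_Mapping.keys (p + q) \<subseteq> ?A"
    by (auto simp: keys_add)
  then show ?thesis
    by (simp add: derivation_of_superset [of ?A] lookup_add smult_mpol_def single_add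
        distrib_right sum.distrib)
qed

lemma derivation_of_zero: "derivation_of f 0 = 0"
  by (simp add: derivation_of_def)

lemma derivation_of_smult: "derivation_of f (smult_mpol c p) = smult_mpol c (derivation_of f p)"
proof -
  have "Poly_Mapping.keys (smult_mpol c p) \<subseteq> Poly_Mapping.keys p"
    by (auto simp: in_keys_iff lookup_smult_mpol)
  then show ?thesis
    by (simp add: derivation_of_superset [of "Poly_Mapping.keys p"] lookup_smult_mpol)
       (simp add: smult_mpol_def sum_distrib_left mult_single mult.assoc [symmetric])
qed

lemma derivation_of_single: "derivation_of f (Poly_Mapping.single m c) = smult_mpol c (mono_deriv f m)"
  by (simp add: derivation_of_superset [of "{m}"])

lemma derivation_of_X: "derivation_of f (X v) = f v"
  by (simp add: X_def derivation_of_single mono_deriv_def smult_mpol_def)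

lemma mono_deriv_superset:
  assumes "finite A" "Poly_Mapping.keys m \<subseteq> A"
  shows "mono_deriv f m = (\<Sum>v\<in>A.
     of_nat (Poly_Mapping.lookup m v) * Poly_Mapping.single (m - Poly_Mapping.single v 1) 1 * f v)"
  unfolding mono_deriv_def
  by (rule sum.mono_neutral_left [OF assms]) (auto simp: in_keys_iff)

lemma mono_deriv_mult:
  fixes f :: "var \<Rightarrow> 'k::comm_ring_1 mpol"
  shows "mono_deriv f (m + n) =
    mono_deriv f m * Poly_Mapping.single n 1 + Poly_Mapping.single m 1 * mono_deriv f n"
proof -
  let ?A = "Poly_Mapping.keys m \<union> Poly_Mapping.keys n"
  let ?s = "\<lambda>a. Poly_Mapping.single a (1::'k)"
  let ?e = "\<lambda>v. Poly_Mapping.single v (1::nat)"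
  have A: "finite ?A" "Poly_Mapping.keys (m + n) \<subseteq> ?A"
    by (auto simp: keys_add)
  have *: "of_nat (Poly_Mapping.lookup a v) * ?s (a + b - ?e v) =
      of_nat (Poly_Mapping.lookup a v) * (?s (a - ?e v) * ?s b)" for a b v
  proof (cases "Poly_Mapping.lookup a v = 0")
    case False
    then have "a + b - ?e v = (a - ?e v) + b"
      by (intro poly_mapping_eqI) (auto simp: lookup_add lookup_minus lookup_single when_def)
    then show ?thesis
      by (simp add: mult_single)
  qed simp
  have "of_nat (Poly_Mapping.lookup (m + n) v) * ?s (m + n - ?e v) * f v =
      of_nat (Poly_Mapping.lookup m v) * ?s (m - ?e v) * f v * ?s n +
      ?s m * (of_nat (Poly_Mapping.lookup n v) * ?s (n - ?e v) * f v)" for v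
    using * [of m v n] * [of n v m]
    by (simp add: lookup_add distrib_right distrib_left add.commute [of n m] mult_ac)
  then show ?thesis
    using A by (simp add: mono_deriv_superset [of ?A] sum.distrib sum_distrib_left sum_distrib_right)
qed

lemma derivation_of_mult:
  "derivation_of f (p * q) = derivation_of f p * q + p * derivation_of f q"
proof (induction p rule: mpol_induct)
  case (2 m c)
  show ?case
  proof (induction q rule: mpol_induct)
    case (2 n e)
    have n: "Poly_Mapping.single n e = smult_mpol e (Poly_Mapping.single n 1)"
      and m: "Poly_Mapping.single m c = smult_mpol c (Poly_Mapping.single m 1)"
      by (simp_all add: smult_mpol_def mult_single)
    have "derivation_of f (Poly_Mapping.single m c * Poly_Mapping.single n e) =
        smult_mpol (c * e) (mono_deriv f (m + n))"
      by (simp add: mult_single derivation_of_single)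
    also have "\<dots> = smult_mpol c (mono_deriv f m) * smult_mpol e (Poly_Mapping.single n 1) +
        smult_mpol c (Poly_Mapping.single m 1) * smult_mpol e (mono_deriv f n)"
    proof -
      have ce: "smult_mpol (c * e) r = smult_mpol c (smult_mpol e r)" for r
        by (simp add: smult_mpol_def mult_single mult.assoc [symmetric])
      show ?thesis
        unfolding ce mono_deriv_mult unfolding smult_mpol_def by (simp only: distrib_left mult_ac)
    qed
    finally show ?case
      unfolding n [symmetric] m [symmetric] by (simp add: derivation_of_single)
  qed (simp_all add: derivation_of_zero derivation_of_add distrib_left)
qed (simp_all add: derivation_of_zero derivation_of_add distrib_right)

lemma D_X: "D (X (k, i)) = of_nat i * X (k, i - 1)" "D (X (k, 0)) = 0"
  by (simp_all add: D_def derivation_of_X)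

lemma Dstar_X:
  "Dstar d (X (k, i)) = of_nat (d ! k - i) * X (k, i + 1)" "Dstar d (X (k, d ! k)) = 0"
  by (simp_all add: Dstar_def derivation_of_X)

end

theory Submission
  imports
    Defs
    "HOL-Computational_Algebra.Formal_Laurent_Series"
begin

text \<open>
  $D$ and $D^*$ generate an action of sl2 for which the power products are weight vectors, $D$
  raising the weight by 2. As they act locally nilpotently, $D$ is injective on negative
  weights and surjective onto positive ones, so rank-nullity gives
  $\dim (S_d)_m = c_0 + c_1$ and $\dim (I_d)_m = c_0 - c_2$, with $c_w$ the number of power products
  of degree $m$ and weight $w$. For $d = (2, \ldots, 2)$ these numbers are coefficients of
  $((1 - t)(1 - t z)(1 - t z^2))^{-n}$. The right-hand sides come from expanding
  $((1 - t z)(1 - t z^2))^{-n}$ at $t = 1$ (the principal part of the partial fraction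
  decomposition there); no poles need to be handled, because Vandermonde's identity
  \[ \sum_{k=1}^n (-1)^{n-k} {m + k - 1 \choose k - 1} {p \choose n - k} = {n + m - p - 1 \choose m - p} \]
  for $p \<le> m$ compares the coefficients directly.
\<close>

section \<open>Rank-nullity on a finite-dimensional subspace\<close>

text \<open>A basis \<open>B1\<close> of the kernel extends to a basis \<open>B\<close> of
  \<open>S\<close>, and \<open>f\<close> maps \<open>B - B1\<close> to a basis of the image.
  Finiteness is asked of \<open>S\<close> alone, since the polynomial spaces are
  infinite-dimensional.\<close>

lemma (in vector_space_pair) dim_eq_dim_kernel_plus_dim_image:
  assumes f: "Vector_Spaces.linear s1 s2 f" and S: "vs1.subspace S" and fin: "finite F" "S \<subseteq> vs1.span F"
  shows "vs1.dim S = vs1.dim {x \<in> S. f x = 0} + vs2.dim (f ` S)"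
proof -
  let ?K = "{x \<in> S. f x = 0}"
  obtain B1 where B1: "B1 \<subseteq> ?K" "vs1.independent B1" "?K \<subseteq> vs1.span B1" "card B1 = vs1.dim ?K"
    using vs1.basis_exists by blast
  obtain B where B: "B1 \<subseteq> B" "B \<subseteq> S" "vs1.independent B" "S \<subseteq> vs1.span B"
    using vs1.maximal_independent_subset_extend[of B1 S] B1 by blast
  have finB: "finite B"
    using vs1.independent_span_bound[OF fin(1) B(3)] B(2) fin(2) by blast
  let ?C = "B - B1"
  have "vs1.independent ?C"
    using B(3) vs1.independent_mono by blast
  have inj: "inj_on f (vs1.span ?C)"
  proof (subst linear_inj_on_iff_eq_0[OF f vs1.subspace_span], safe)
    fix x assume x: "x \<in> vs1.span ?C" "f x = 0"
    have "vs1.span ?C \<subseteq> S"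
      using B(2) S by (meson Diff_subset order_trans vs1.span_minimal)
    with x have x1: "x \<in> vs1.span B1"
      using B1(3) by blast
    \<comment> \<open>Both agree with the coordinates of \<open>x\<close> in the basis
      \<open>B\<close>, so a nonzero coordinate would belong to a vector lying in \<open>B1\<close>
      and in \<open>B - B1\<close>.\<close>
    have "vs1.representation ?C x = vs1.representation B1 x"
      using vs1.representation_extend[OF B(3) x(1)] vs1.representation_extend[OF B(3) x1] B(1)
      by auto
    then have "vs1.representation ?C x b = 0" for b
      using vs1.representation_ne_zero[of ?C x b] vs1.representation_ne_zero[of B1 x b] by auto
    then show "x = 0"
      using vs1.sum_nonzero_representation_eq[OF \<open>vs1.independent ?C\<close> x(1)] by simp
  qed
  then have ind: "vs2.independent (f ` ?C)"
    using linear_independent_injective_image[OF f \<open>vs1.independent ?C\<close>] by blast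
  have "f ` S \<subseteq> vs2.span (f ` ?C)"
  proof -
    have "f ` S \<subseteq> f ` vs1.span B"
      using B(4) by blast
    also have "\<dots> = vs2.span (f ` B)"
      by (simp add: linear_span_image[OF f])
    also have "\<dots> \<subseteq> vs2.span (f ` ?C)"
    proof (rule vs2.span_minimal)
      show "f ` B \<subseteq> vs2.span (f ` ?C)"
      proof safe
        fix b assume "b \<in> B"
        show "f b \<in> vs2.span (f ` ?C)"
        proof (cases "b \<in> B1")
          case True
          then show ?thesis using B1(1) vs2.span_zero by auto
        next
          case False
          then show ?thesis using \<open>b \<in> B\<close> by (intro vs2.span_base) blast
        qed
      qed
    qed simp
    finally show ?thesis .
  qed
  moreover have "f ` ?C \<subseteq> f ` S"
    using B(2) by blast
  ultimately have "card (f ` ?C) = vs2.dim (f ` S)"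
    using ind vs2.basis_card_eq_dim by blast
  moreover have "card (f ` ?C) = card ?C"
    by (meson card_image inj inj_on_subset vs1.span_superset)
  moreover have "card B = vs1.dim S"
    using B vs1.basis_card_eq_dim by blast
  moreover have "card B = card B1 + card ?C"
    using B(1) finB by (metis add.commute card_Diff_subset card_mono finite_subset le_add_diff_inverse2)
  ultimately show ?thesis
    using B1(4) by simp
qed

subsection \<open>Weight spaces\<close>

interpretation mpol: vector_space "smult_mpol :: 'k::field \<Rightarrow> _"
  by (rule vector_space_smult_mpol)

interpretation mpol_pair: vector_space_pair
  "smult_mpol :: 'k::field \<Rightarrow> _" "smult_mpol :: 'k::field \<Rightarrow> _"
  by standard

lemma linear_derivation_of:
  "Vector_Spaces.linear (smult_mpol :: 'k::field \<Rightarrow> _) smult_mpol (derivation_of f)"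
  by (simp add: Vector_Spaces.linear_iff derivation_of_add derivation_of_smult
      mpol.vector_space_axioms)

text \<open>Described by supports rather than as a linear span, so that membership is checked
  coefficientwise; \<open>mspan_eq_span\<close> reconciles the two over a field.\<close>

definition mspan :: "(var \<Rightarrow>\<^sub>0 nat) set \<Rightarrow> 'k::comm_ring_1 mpol set" where
  "mspan S = {p. Poly_Mapping.keys p \<subseteq> S}"

abbreviation pp :: "(var \<Rightarrow>\<^sub>0 nat) \<Rightarrow> 'k::comm_ring_1 mpol" where
  "pp m \<equiv> Poly_Mapping.single m 1"

lemma mspan_iff: "p \<in> mspan S \<longleftrightarrow> (\<forall>m. m \<notin> S \<longrightarrow> Poly_Mapping.lookup p m = 0)"
  by (auto simp: mspan_def in_keys_iff)

lemma pp_sum: "p = (\<Sum>m\<in>Poly_Mapping.keys p. smult_mpol (Poly_Mapping.lookup p m) (pp m))"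
  by (intro poly_mapping_eqI)
     (simp add: lookup_sum lookup_smult_mpol lookup_single when_def in_keys_iff
       if_distrib[where f = "(*) _"] cong: if_cong)

lemma subspace_mspan: "mpol.subspace (mspan S)"
  by (auto simp: mpol.subspace_def mspan_iff lookup_add lookup_smult_mpol)

lemma pp_in_mspan: "m \<in> S \<Longrightarrow> pp m \<in> mspan S"
  by (simp add: mspan_iff lookup_single when_def)

lemma mspan_mono: "S \<subseteq> T \<Longrightarrow> mspan S \<subseteq> mspan T"
  by (auto simp: mspan_def)

lemma mspan_subset_subspace:
  fixes V :: "'k::field mpol set"
  assumes "mpol.subspace V" "\<And>m. m \<in> S \<Longrightarrow> pp m \<in> V"
  shows "mspan S \<subseteq> V"
proof
  fix p :: "'k mpol"
  assume "p \<in> mspan S"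
  then have "(\<Sum>m\<in>Poly_Mapping.keys p. smult_mpol (Poly_Mapping.lookup p m) (pp m)) \<in> V"
    using assms by (intro mpol.subspace_sum mpol.subspace_scale) (auto simp: mspan_def)
  then show "p \<in> V"
    using pp_sum[of p] by simp
qed

lemma mspan_eq_span: "mspan S = mpol.span (pp ` S)"
proof
  show "mspan S \<subseteq> mpol.span (pp ` S)"
    by (intro mspan_subset_subspace) (auto intro: mpol.span_base)
  show "mpol.span (pp ` S) \<subseteq> mspan S"
    by (intro mpol.span_minimal) (auto simp: subspace_mspan pp_in_mspan)
qed

lemma inj_pp: "inj (pp :: _ \<Rightarrow> 'k::comm_ring_1 mpol)"
proof (rule injI)
  fix m m' assume "pp m = (pp m' :: 'k mpol)"
  then have "Poly_Mapping.lookup (pp m :: 'k mpol) m = Poly_Mapping.lookup (pp m' :: 'k mpol) m"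
    by simp
  then show "m = m'"
    by (auto simp: lookup_single when_def split: if_splits)
qed

lemma independent_monos: "\<not> mpol.dependent (pp ` S :: 'k::field mpol set)"
proof
  assume "mpol.dependent (pp ` S :: 'k mpol set)"
  then obtain m where m: "m \<in> S" "(pp m :: 'k mpol) \<in> mpol.span (pp ` S - {pp m})"
    unfolding mpol.dependent_def by auto
  have "(pp ` S - {pp m} :: 'k mpol set) = pp ` (S - {m})"
    using inj_pp by (auto simp: inj_on_def)
  with m have "(pp m :: 'k mpol) \<in> mspan (S - {m})"
    by (simp add: mspan_eq_span)
  then show False
    by (simp add: mspan_def)
qed

lemma dim_mspan: "mpol.dim (mspan S :: 'k::field mpol set) = card S"
  using mpol.dim_span_eq_card_independent[OF independent_monos[of S]]
  by (simp add: mspan_eq_span card_image[OF inj_on_subset[OF inj_pp]])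

section \<open>Additive gradings of power products: degree and weight\<close>

text \<open>Common form of the total degree (\<open>f\<close> constantly 1) and the weight. Values
  lie in a ring, so that removing a factor \<open>v\<close> can subtract \<open>f v\<close>.\<close>

definition grading :: "(var \<Rightarrow> 'a::comm_ring_1) \<Rightarrow> (var \<Rightarrow>\<^sub>0 nat) \<Rightarrow> 'a" where
  "grading f m = (\<Sum>v\<in>Poly_Mapping.keys m. of_nat (Poly_Mapping.lookup m v) * f v)"

lemma grading_superset:
  "finite A \<Longrightarrow> Poly_Mapping.keys m \<subseteq> A \<Longrightarrow>
    grading f m = (\<Sum>v\<in>A. of_nat (Poly_Mapping.lookup m v) * f v)"
  unfolding grading_def by (rule sum.mono_neutral_left) (auto simp: in_keys_iff)

lemma grading_add: "grading f (m + n) = grading f m + grading f n"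
proof -
  let ?A = "Poly_Mapping.keys m \<union> Poly_Mapping.keys n"
  have "finite ?A" "Poly_Mapping.keys (m + n) \<subseteq> ?A"
    by (auto simp: keys_add)
  then show ?thesis
    by (simp add: grading_superset[of ?A] lookup_add distrib_right sum.distrib)
qed

lemma grading_single: "grading f (Poly_Mapping.single v 1) = f v"
  by (simp add: grading_def)

lemma diff_single_add:
  fixes m :: "'a \<Rightarrow>\<^sub>0 nat"
  assumes "v \<in> Poly_Mapping.keys m"
  shows "m - Poly_Mapping.single v 1 + Poly_Mapping.single v 1 = m"
  using assms
  by (intro poly_mapping_eqI) (auto simp: lookup_add lookup_minus lookup_single when_def in_keys_iff)

lemma grading_diff_single:
  "v \<in> Poly_Mapping.keys m \<Longrightarrow> grading f (m - Poly_Mapping.single v 1) = grading f m - f v"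
  by (metis diff_single_add grading_add grading_single add_diff_cancel_right')

lemma mdeg_eq_grading: "int (mdeg m) = grading (\<lambda>_. 1) m"
  by (simp add: mdeg_def grading_def)

lemma finite_monomials:
  assumes "finite A"
  shows "finite {m. Poly_Mapping.keys m \<subseteq> A \<and> mdeg m = N}"
proof -
  let ?F = "{f. \<forall>x. (x \<in> A \<longrightarrow> f x \<in> {..N}) \<and> (x \<notin> A \<longrightarrow> f x = (0::nat))}"
  have "finite ?F"
    using assms by (intro finite_set_of_finite_funs) auto
  moreover have "Poly_Mapping.lookup ` {m. Poly_Mapping.keys m \<subseteq> A \<and> mdeg m = N} \<subseteq> ?F"
  proof safe
    fix m v assume "Poly_Mapping.keys (m :: var \<Rightarrow>\<^sub>0 nat) \<subseteq> A"
    show "Poly_Mapping.lookup m v \<le> mdeg m"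
      by (cases "v \<in> Poly_Mapping.keys m")
         (auto simp: mdeg_def in_keys_iff intro: member_le_sum[where f = "Poly_Mapping.lookup m"])
  qed (auto simp: in_keys_iff)
  ultimately have "finite (Poly_Mapping.lookup ` {m. Poly_Mapping.keys m \<subseteq> A \<and> mdeg m = N})"
    using finite_subset by blast
  then show ?thesis
    by (rule finite_imageD) (auto simp: inj_on_def intro: poly_mapping_eqI)
qed

text \<open>The sl2 weight: the eigenvalue of the commutator of \<open>D\<close> and
  \<open>Dstar d\<close> on a power product.\<close>

definition weight :: "nat list \<Rightarrow> (var \<Rightarrow>\<^sub>0 nat) \<Rightarrow> int" where
  "weight d = grading (\<lambda>(k, i). int (d ! k) - 2 * int i)"

text \<open>A set of weights is allowed, so that single weight spaces and whole ranges such as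
  \<open>{0..}\<close> are treated alike.\<close>

definition wmonos :: "nat list \<Rightarrow> nat \<Rightarrow> int set \<Rightarrow> (var \<Rightarrow>\<^sub>0 nat) set" where
  "wmonos d N A = {m. Poly_Mapping.keys m \<subseteq> vars_of d \<and> mdeg m = N \<and> weight d m \<in> A}"

abbreviation wspace :: "nat list \<Rightarrow> nat \<Rightarrow> int set \<Rightarrow> 'k::comm_ring_1 mpol set" where
  "wspace d N A \<equiv> mspan (wmonos d N A)"

lemma finite_vars_of: "finite (vars_of d)"
proof -
  have "vars_of d = (SIGMA k:{..<length d}. {..d ! k})"
    by (auto simp: vars_of_def)
  then show ?thesis
    by simp
qed

lemma finite_wmonos: "finite (wmonos d N A)"
  by (rule finite_subset[OF _ finite_monomials[OF finite_vars_of, where N = N]]) (auto simp: wmonos_def)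

lemma wmonos_mono: "A \<subseteq> B \<Longrightarrow> wmonos d N A \<subseteq> wmonos d N B"
  by (auto simp: wmonos_def)

text \<open>Describes one term of a derivation that sends variables to multiples of variables: a
  factor \<open>v\<close> is exchanged for \<open>v'\<close>.\<close>

lemma replace_var_in_wmonos:
  assumes m: "m \<in> wmonos d N A" and v: "v \<in> Poly_Mapping.keys m"
    and v': "v' \<in> vars_of d" and B: "weight d m - weight d (Poly_Mapping.single v 1)
       + weight d (Poly_Mapping.single v' 1) \<in> B"
  shows "m - Poly_Mapping.single v 1 + Poly_Mapping.single v' 1 \<in> wmonos d N B"
proof -
  let ?m = "m - Poly_Mapping.single v 1 + Poly_Mapping.single v' 1"
  have "Poly_Mapping.keys ?m \<subseteq> vars_of d"
    using m v'
    by (auto simp: wmonos_def in_keys_iff lookup_add lookup_minus lookup_single when_def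
        subset_iff split: if_splits)
  moreover have "int (mdeg ?m) = int (mdeg m)"
    using v by (simp add: mdeg_eq_grading grading_add grading_diff_single grading_single del: One_nat_def)
  moreover have "weight d ?m \<in> B"
    using v B by (simp add: weight_def grading_add grading_diff_single grading_single del: One_nat_def)
  ultimately show ?thesis
    using m by (simp add: wmonos_def)
qed

text \<open>By the product rule each term exchanges one variable for another whose weight differs by
  \<open>e\<close>. The condition \<open>f v \<noteq> 0\<close> excludes the boundary variables,
  whose formal targets have the wrong weight or lie outside \<open>vars_of d\<close>.\<close>

lemma derivation_of_in_mspan:
  fixes p :: "'k::field mpol"
  assumes p: "p \<in> wspace d N A"
    and f: "\<And>v. v \<in> vars_of d \<Longrightarrow> f v \<noteq> 0 \<Longrightarrow>
      \<exists>c v'. f v = smult_mpol c (X v') \<and> v' \<in> vars_of d \<and>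
        weight d (Poly_Mapping.single v' 1) = weight d (Poly_Mapping.single v 1) + e"
  shows "derivation_of f p \<in> wspace d N {w. w - e \<in> A}"
proof -
  have "mono_deriv f m \<in> wspace d N {w. w - e \<in> A}" if m: "m \<in> wmonos d N A" for m
    unfolding mono_deriv_def
  proof (intro mpol.subspace_sum subspace_mspan)
    fix v assume v: "v \<in> Poly_Mapping.keys m"
    then have "v \<in> vars_of d"
      using m by (auto simp: wmonos_def)
    show "of_nat (Poly_Mapping.lookup m v) *
        Poly_Mapping.single (m - Poly_Mapping.single v 1) 1 * f v \<in> wspace d N {w. w - e \<in> A}"
    proof (cases "f v = 0")
      case False
      then obtain c v' where fv: "f v = smult_mpol c (X v')" and v': "v' \<in> vars_of d"
        and e: "weight d (Poly_Mapping.single v' 1) = weight d (Poly_Mapping.single v 1) + e"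
        using f[OF \<open>v \<in> vars_of d\<close>] by blast
      have "of_nat (Poly_Mapping.lookup m v) *
          Poly_Mapping.single (m - Poly_Mapping.single v 1) 1 * f v =
        smult_mpol (of_nat (Poly_Mapping.lookup m v) * c)
          (pp (m - Poly_Mapping.single v 1 + Poly_Mapping.single v' 1))"
        by (simp add: fv X_def smult_mpol_def mult_single flip: single_of_nat)
      also have "\<dots> \<in> wspace d N {w. w - e \<in> A}"
        using m v v' e
        by (intro mpol.subspace_scale subspace_mspan pp_in_mspan replace_var_in_wmonos[OF m])
           (auto simp: wmonos_def)
      finally show ?thesis .
    qed (simp add: mpol.subspace_0 subspace_mspan)
  qed
  then show ?thesis
    using p unfolding derivation_of_def mspan_def[of "wmonos d N A"]
    by (intro mpol.subspace_sum mpol.subspace_scale subspace_mspan) auto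
qed

lemma D_in_wspace:
  fixes p :: "'k::field mpol"
  assumes "p \<in> wspace d N A"
  shows "D p \<in> wspace d N {w. w - 2 \<in> A}"
  unfolding D_def
proof (rule derivation_of_in_mspan[OF assms])
  let ?f = "\<lambda>(k, i). of_nat i * X (k, i - 1) :: 'k mpol"
  fix v assume v: "v \<in> vars_of d" "?f v \<noteq> 0"
  obtain k i where ki: "v = (k, i)"
    by (cases v)
  \<comment> \<open>For \<open>i = 0\<close> the truncated \<open>i - 1\<close> would not shift the
    weight, but there the coefficient vanishes.\<close>
  have i: "i \<noteq> 0"
  proof
    assume "i = 0"
    with v(2) show False unfolding ki by simp
  qed
  have "?f v = smult_mpol (of_nat i) (X (k, i - 1))"
    by (simp add: ki smult_mpol_def flip: single_of_nat)
  moreover have "(k, i - 1) \<in> vars_of d"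
    using v(1) by (auto simp: ki vars_of_def)
  moreover have "weight d (Poly_Mapping.single (k, i - 1) 1) = weight d (Poly_Mapping.single v 1) + 2"
    using i unfolding ki weight_def grading_single by (simp add: of_nat_diff)
  ultimately show "\<exists>c v'. ?f v = smult_mpol c (X v') \<and> v' \<in> vars_of d \<and>
      weight d (Poly_Mapping.single v' 1) = weight d (Poly_Mapping.single v 1) + 2"
    by (intro exI[of _ "of_nat i"] exI[of _ "(k, i - 1)"] conjI)
qed

lemma Dstar_in_wspace:
  fixes p :: "'k::field mpol"
  assumes "p \<in> wspace d N A"
  shows "Dstar d p \<in> wspace d N {w. w + 2 \<in> A}"
proof -
  let ?f = "\<lambda>(k, i). of_nat (d ! k - i) * X (k, i + 1) :: 'k mpol"
  have "derivation_of ?f p \<in> wspace d N {w. w - (- 2) \<in> A}"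
  proof (rule derivation_of_in_mspan[OF assms])
    fix v assume v: "v \<in> vars_of d" "?f v \<noteq> 0"
    obtain k i where ki: "v = (k, i)"
      by (cases v)
    \<comment> \<open>This keeps \<open>(k, i + 1)\<close> inside \<open>vars_of d\<close>.\<close>
    have i: "d ! k - i \<noteq> 0"
    proof
      assume "d ! k - i = 0"
      with v(2) show False unfolding ki by simp
    qed
    have "?f v = smult_mpol (of_nat (d ! k - i)) (X (k, i + 1))"
      by (simp add: ki smult_mpol_def flip: single_of_nat)
    moreover have "(k, i + 1) \<in> vars_of d"
      using v(1) i by (auto simp: ki vars_of_def)
    moreover have "weight d (Poly_Mapping.single (k, i + 1) 1) =
        weight d (Poly_Mapping.single v 1) + - 2"
      unfolding ki weight_def grading_single by simp
    ultimately show "\<exists>c v'. ?f v = smult_mpol c (X v') \<and> v' \<in> vars_of d \<and>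
        weight d (Poly_Mapping.single v' 1) = weight d (Poly_Mapping.single v 1) + - 2"
      by (intro exI[of _ "of_nat (d ! k - i)"] exI[of _ "(k, i + 1)"] conjI)
  qed
  then show ?thesis by (simp add: Dstar_def)
qed

lemma D_linear: "D (p + q) = D p + D q" "D (smult_mpol c p) = smult_mpol c (D p)" "D 0 = 0"
  by (simp_all add: D_def derivation_of_add derivation_of_smult derivation_of_zero)

lemma Dstar_linear:
  "Dstar d (p + q) = Dstar d p + Dstar d q"
  "Dstar d (smult_mpol c p) = smult_mpol c (Dstar d p)" "Dstar d 0 = 0"
  by (simp_all add: Dstar_def derivation_of_add derivation_of_smult derivation_of_zero)

text \<open>Euler's identity with weights: multiplying the partial derivative by the variable
  \<open>v\<close> again restores the power product, times the exponent of \<open>v\<close>.\<close>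

lemma derivation_of_weight:
  fixes m :: "var \<Rightarrow>\<^sub>0 nat" and f :: "var \<Rightarrow> int"
  shows "derivation_of (\<lambda>v. smult_mpol (of_int (f v)) (X v)) (pp m :: 'k::field mpol) =
    smult_mpol (of_int (grading f m)) (pp m)"
proof -
  have "mono_deriv (\<lambda>v. smult_mpol (of_int (f v)) (X v)) m =
      (\<Sum>v\<in>Poly_Mapping.keys m. smult_mpol (of_int (int (Poly_Mapping.lookup m v) * f v)) (pp m :: 'k mpol))"
    unfolding mono_deriv_def
  proof (rule sum.cong[OF refl])
    fix v assume "v \<in> Poly_Mapping.keys m"
    from diff_single_add[OF this]
    show "of_nat (Poly_Mapping.lookup m v) * Poly_Mapping.single (m - Poly_Mapping.single v 1) 1 *
        smult_mpol (of_int (f v)) (X v) =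
      smult_mpol (of_int (int (Poly_Mapping.lookup m v) * f v)) (pp m :: 'k mpol)"
      by (simp add: X_def smult_mpol_def mult_single flip: single_of_nat single_of_int)
  qed
  also have "\<dots> = smult_mpol (of_int (grading f m)) (pp m)"
    by (simp add: grading_def mpol.scale_sum_left)
  finally show ?thesis
    by (simp add: derivation_of_single)
qed

subsection \<open>The action of sl2\<close>

text \<open>Induction on the degree of power products, then on sums. The variable step suits
  identities between derivations, which the product rule reduces to variables.\<close>

lemma mult_pp_induct [consumes 1, case_names one var_mult zero add]:
  fixes p :: "'k::comm_ring_1 mpol"
  assumes p: "p \<in> poly_alg d"
    and one: "\<And>c. P (smult_mpol c 1)"
    and mult: "\<And>v q. v \<in> vars_of d \<Longrightarrow> P q \<Longrightarrow> P (X v * q)"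
    and zero: "P 0" and add: "\<And>p q. P p \<Longrightarrow> P q \<Longrightarrow> P (p + q)"
  shows "P p"
proof -
  have P: "P (Poly_Mapping.single m c)" if "Poly_Mapping.keys m \<subseteq> vars_of d" for m c
    using that
  proof (induction "mdeg m" arbitrary: m)
    case 0
    then have "m = 0"
      by (intro poly_mapping_eqI) (auto simp: mdeg_def in_keys_iff)
    then show ?case
      using one[of c] by (simp add: smult_mpol_def)
  next
    case (Suc N)
    then obtain v where v: "v \<in> Poly_Mapping.keys m"
      by (metis Zero_not_Suc all_not_in_conv mdeg_def sum.empty)
    let ?m = "m - Poly_Mapping.single v 1"
    have m: "m = Poly_Mapping.single v 1 + ?m"
      using diff_single_add[OF v] by (simp add: add.commute)
    have "int (mdeg ?m) = int (mdeg m) - 1"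
      using v by (simp add: mdeg_eq_grading grading_diff_single del: One_nat_def)
    then have "N = mdeg ?m"
      using Suc by simp
    moreover have "Poly_Mapping.keys ?m \<subseteq> vars_of d"
      using Suc.prems by (auto simp: in_keys_iff lookup_minus)
    ultimately have "P (X v * Poly_Mapping.single ?m c)"
      using Suc v by (intro mult) auto
    then show ?case
      using m by (simp add: X_def mult_single)
  qed
  have "P (\<Sum>m\<in>M. Poly_Mapping.single m (Poly_Mapping.lookup p m))"
    if "finite M" "M \<subseteq> Poly_Mapping.keys p" for M
    using that
  proof (induction M)
    case (insert m M)
    then show ?case
      using p by (auto intro!: add P simp: poly_alg_def)
  qed (simp add: zero)
  from this[of "Poly_Mapping.keys p"] show ?thesis
    using pp_sum[of p] by (simp add: smult_mpol_def mult_single)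
qed

lemma weight_derivation:
  fixes p :: "'k::field mpol"
  assumes "p \<in> wspace d N {w}"
  shows "derivation_of (\<lambda>(k, i). smult_mpol (of_int (int (d ! k) - 2 * int i)) (X (k, i))) p =
    smult_mpol (of_int w) p"
proof -
  have "derivation_of (\<lambda>(k, i). smult_mpol (of_int (int (d ! k) - 2 * int i)) (X (k, i))) p =
    (\<Sum>m\<in>Poly_Mapping.keys p. smult_mpol (Poly_Mapping.lookup p m)
      (derivation_of (\<lambda>v. smult_mpol (of_int ((\<lambda>(k, i). int (d ! k) - 2 * int i) v)) (X v)) (pp m)))"
    by (simp add: derivation_of_def derivation_of_single case_prod_unfold)
  also have "\<dots> = (\<Sum>m\<in>Poly_Mapping.keys p. smult_mpol (of_int w)
      (smult_mpol (Poly_Mapping.lookup p m) (pp m)))"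
    unfolding derivation_of_weight
  proof (intro sum.cong refl)
    fix m assume "m \<in> Poly_Mapping.keys p"
    then have "grading (\<lambda>(k, i). int (d ! k) - 2 * int i) m = w"
      using assms by (auto simp: mspan_def wmonos_def weight_def)
    then show "smult_mpol (Poly_Mapping.lookup p m)
        (smult_mpol (of_int (grading (\<lambda>(k, i). int (d ! k) - 2 * int i) m)) (pp m)) =
      smult_mpol (of_int w) (smult_mpol (Poly_Mapping.lookup p m) (pp m))"
      by (simp only: mpol.scale_left_commute)
  qed
  also have "\<dots> = smult_mpol (of_int w) p"
    by (simp only: mpol.scale_sum_right[symmetric] pp_sum[symmetric])
  finally show ?thesis .
qed

lemma wspace_subset_poly_alg: "wspace d N A \<subseteq> poly_alg d"
  by (auto simp: mspan_def wmonos_def poly_alg_def)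

text \<open>A commutator of derivations is a derivation, so it is determined on variables, where (d
  - i)(i + 1) - i (d - i + 1) = d - 2 i.\<close>

lemma D_Dstar_commutator_derivation:
  fixes p :: "'k::field mpol"
  assumes "p \<in> poly_alg d"
  shows "D (Dstar d p) = Dstar d (D p) +
    derivation_of (\<lambda>(k, i). smult_mpol (of_int (int (d ! k) - 2 * int i)) (X (k, i))) p"
  using assms
proof (induction rule: mult_pp_induct)
  case (one c)
  show ?case
    by (simp add: D_linear Dstar_linear derivation_of_smult)
       (simp add: D_def Dstar_def derivation_of_single mono_deriv_def smult_mpol_def derivation_of_zero
         flip: single_one)
next
  case (var_mult v q)
  obtain k i where v: "v = (k, i)" and i: "i \<le> d ! k"
    using var_mult(1) by (auto simp: vars_of_def)
  let ?H = "derivation_of (\<lambda>(k, i). smult_mpol (of_int (int (d ! k) - 2 * int i) :: 'k) (X (k, i)))"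
  have nat: "of_nat j * r = smult_mpol (of_nat j :: 'k) r" for j r
    by (simp add: smult_mpol_def flip: single_of_nat)
  have "D (Dstar d (X v)) = smult_mpol (of_nat ((d ! k - i) * (i + 1)) :: 'k) (X v)"
    by (simp add: v D_X Dstar_X nat D_linear del: of_nat_Suc of_nat_add mult_Suc_right)
  moreover have "Dstar d (D (X v)) = smult_mpol (of_nat (i * (d ! k - i + 1)) :: 'k) (X v)"
  proof (cases i)
    case (Suc j)
    then have "d ! k - j = d ! k - i + 1"
      using i by simp
    then show ?thesis
      using Suc by (simp add: v D_X Dstar_X nat Dstar_linear del: of_nat_Suc of_nat_add mult_Suc mult_Suc_right)
  qed (simp add: v D_X Dstar_linear)
  moreover have "?H (X v) = smult_mpol (of_int (int (d ! k) - 2 * int i) :: 'k) (X v)"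
    by (simp add: v derivation_of_X)
  moreover have "(of_nat ((d ! k - i) * (i + 1)) :: 'k) =
      of_nat (i * (d ! k - i + 1)) + of_int (int (d ! k) - 2 * int i)"
  \<comment> \<open>Writing \<open>d ! k = i + e\<close> removes the truncated subtraction.\<close>
  proof -
    obtain e where "d ! k = i + e"
      using i le_Suc_ex by blast
    then show ?thesis
      by (simp add: algebra_simps)
  qed
  ultimately have X: "D (Dstar d (X v)) = Dstar d (D (X v)) + ?H (X v)"
    by (simp only: mpol.scale_left_distrib)
  have D: "D (p * q) = D p * q + p * D q"
    and Dstar: "Dstar d (p * q) = Dstar d p * q + p * Dstar d q" for p q :: "'k mpol"
    by (simp_all add: D_def Dstar_def derivation_of_mult)
  \<comment> \<open>The last bracket is symmetric in \<open>D\<close> and \<open>Dstar d\<close>, so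
    it also occurs in \<open>Dstar d (D (X v * q))\<close> and cancels in the commutator.\<close>
  have "D (Dstar d (X v * q)) = D (Dstar d (X v)) * q + X v * D (Dstar d q) +
      (Dstar d (X v) * D q + D (X v) * Dstar d q)"
    by (simp add: D Dstar D_linear algebra_simps)
  also have "\<dots> = Dstar d (D (X v * q)) + (?H (X v) * q + X v * ?H q)"
    unfolding X var_mult(2) by (simp add: D Dstar Dstar_linear algebra_simps)
  finally show ?case
    by (simp add: derivation_of_mult)
next
  case zero
  then show ?case by (simp add: D_linear Dstar_linear derivation_of_zero)
next
  case (add p q)
  then show ?case by (simp add: D_linear Dstar_linear derivation_of_add algebra_simps)
qed

lemma D_Dstar_commutator:
  fixes p :: "'k::field mpol"
  assumes "p \<in> wspace d N {w}"
  shows "D (Dstar d p) = Dstar d (D p) + smult_mpol (of_int w) p"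
  using D_Dstar_commutator_derivation[of p d] subsetD[OF wspace_subset_poly_alg assms]
  by (simp only: weight_derivation[OF assms])

lemma D_funpow_in_wspace:
  fixes p :: "'k::field mpol"
  shows "p \<in> wspace d N {w} \<Longrightarrow> (D ^^ k) p \<in> wspace d N {w + 2 * int k}"
proof (induction k)
  case (Suc k)
  then have "D ((D ^^ k) p) \<in> wspace d N {v. v - 2 \<in> {w + 2 * int k}}"
    by (intro D_in_wspace)
  also have "{v. v - 2 \<in> {w + 2 * int k}} = {w + 2 * int (Suc k)}"
    by auto
  finally show ?case by simp
qed simp

lemma Dstar_funpow_in_wspace:
  fixes p :: "'k::field mpol"
  shows "p \<in> wspace d N {w} \<Longrightarrow> (Dstar d ^^ k) p \<in> wspace d N {w - 2 * int k}"
proof (induction k)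
  case (Suc k)
  then have "Dstar d ((Dstar d ^^ k) p) \<in> wspace d N {v. v + 2 \<in> {w - 2 * int k}}"
    by (intro Dstar_in_wspace)
  also have "{v. v + 2 \<in> {w - 2 * int k}} = {w - 2 * int (Suc k)}"
    by auto
  finally show ?case by simp
qed simp

text \<open>Moving \<open>Dstar d\<close> past k + 1 copies of \<open>D\<close> collects the weights
  w, w + 2, ..., w + 2 k, whose sum is (k + 1)(w + k).\<close>

lemma D_funpow_Dstar:
  fixes p :: "'k::field mpol"
  assumes p: "p \<in> wspace d N {w}"
  shows "(D ^^ Suc k) (Dstar d p) = Dstar d ((D ^^ Suc k) p) +
    smult_mpol (of_int (int (Suc k) * (w + int k))) ((D ^^ k) p)"
proof (induction k)
  case 0
  then show ?case using D_Dstar_commutator[OF p] by simp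
next
  case (Suc k)
  have "(D ^^ Suc (Suc k)) (Dstar d p) = D (Dstar d ((D ^^ Suc k) p)) +
      smult_mpol (of_int (int (Suc k) * (w + int k))) ((D ^^ Suc k) p)"
    using Suc by (simp add: D_linear)
  also have "D (Dstar d ((D ^^ Suc k) p)) = Dstar d ((D ^^ Suc (Suc k)) p) +
      smult_mpol (of_int (w + 2 * int (Suc k))) ((D ^^ Suc k) p)"
    using D_Dstar_commutator[OF D_funpow_in_wspace[OF p, of "Suc k"]]
    by (simp only: funpow.simps comp_def)
  also have "\<dots> + smult_mpol (of_int (int (Suc k) * (w + int k))) ((D ^^ Suc k) p) =
      Dstar d ((D ^^ Suc (Suc k)) p) +
      smult_mpol (of_int (w + 2 * int (Suc k) + int (Suc k) * (w + int k))) ((D ^^ Suc k) p)"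
    by (simp only: of_int_add mpol.scale_left_distrib add.assoc)
  also have "w + 2 * int (Suc k) + int (Suc k) * (w + int k) = int (Suc (Suc k)) * (w + int (Suc k))"
    by (simp add: algebra_simps)
  finally show ?case .
qed

text \<open>The mirror computation for a highest weight vector: the collected weights w, w - 2, ...,
  w - 2 k sum to (k + 1)(w - k).\<close>

lemma D_Dstar_funpow:
  fixes p :: "'k::field mpol"
  assumes p: "p \<in> wspace d N {w}" and "D p = 0"
  shows "D ((Dstar d ^^ Suc k) p) =
    smult_mpol (of_int (int (Suc k) * (w - int k))) ((Dstar d ^^ k) p)"
proof (induction k)
  case 0
  then show ?case using D_Dstar_commutator[OF p] assms(2) by (simp add: Dstar_linear)
next
  case (Suc k)
  have "D ((Dstar d ^^ Suc (Suc k)) p) = Dstar d (D ((Dstar d ^^ Suc k) p)) +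
      smult_mpol (of_int (w - 2 * int (Suc k))) ((Dstar d ^^ Suc k) p)"
    using D_Dstar_commutator[OF Dstar_funpow_in_wspace[OF p, of "Suc k"]]
    by (simp only: funpow.simps comp_def)
  also have "\<dots> = smult_mpol
      (of_int (int (Suc k) * (w - int k) + (w - 2 * int (Suc k)))) ((Dstar d ^^ Suc k) p)"
    unfolding Suc by (simp only: Dstar_linear of_int_add mpol.scale_left_distrib funpow.simps comp_def)
  also have "int (Suc k) * (w - int k) + (w - 2 * int (Suc k)) =
      int (Suc (Suc k)) * (w - int (Suc k))"
    by (simp add: algebra_simps)
  finally show ?case .
qed

section \<open>Injectivity and surjectivity of \<open>D\<close> on weight spaces\<close>

text \<open>A fixed degree has finitely many power products, hence bounded weights. This is the
  source of the local nilpotency of \<open>D\<close> and \<open>Dstar d\<close>.\<close>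

lemma wspace_eq_zero_outside:
  obtains B where "\<And>w. \<bar>w\<bar> > B \<Longrightarrow> wspace d N {w} = {0 :: 'k::comm_ring_1 mpol}"
proof -
  have fin: "finite ((\<lambda>m. \<bar>weight d m\<bar>) ` wmonos d N UNIV)"
    by (intro finite_imageI finite_wmonos)
  have "wspace d N {w} = {0 :: 'k mpol}"
    if w: "\<bar>w\<bar> > Max (insert 0 ((\<lambda>m. \<bar>weight d m\<bar>) ` wmonos d N UNIV))" for w
  proof -
    have "wmonos d N {w} = {}"
    proof (rule ccontr)
      assume "wmonos d N {w} \<noteq> {}"
      then obtain m where "m \<in> wmonos d N UNIV" "weight d m = w"
        by (auto simp: wmonos_def)
      then have "\<bar>w\<bar> \<le> Max (insert 0 ((\<lambda>m. \<bar>weight d m\<bar>) ` wmonos d N UNIV))"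
        using fin by (intro Max_ge) auto
      with w show False by simp
    qed
    then show ?thesis
      by (auto simp: mspan_def)
  qed
  then show thesis by (rule that)
qed

text \<open>For \<open>w < 0\<close> the factors (k + 1)(w - k) are nonzero in characteristic 0, so
  the vanishing of a power of \<open>Dstar d\<close> at \<open>p\<close> descends step by step to
  \<open>p = 0\<close>.\<close>

lemma D_injective_on_negative_weight:
  fixes p :: "'k::field_char_0 mpol"
  assumes p: "p \<in> wspace d N {w}" and w: "w < 0" and D0: "D p = 0"
  shows "p = 0"
proof -
  have *: "p = 0" if "(Dstar d ^^ k) p = 0" for k
    using that
  proof (induction k)
    case (Suc k)
    have "smult_mpol (of_int (int (Suc k) * (w - int k))) ((Dstar d ^^ k) p) = 0"
      using D_Dstar_funpow[OF p D0, of k] Suc.prems by (simp only: D_linear)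
    moreover have "(of_int (int (Suc k) * (w - int k)) :: 'k) \<noteq> 0"
      using w by (simp only: of_int_eq_0_iff) simp
    ultimately show ?case
      using Suc.IH by (simp only: mpol.scale_eq_0_iff) blast
  qed simp
  obtain B where B: "\<And>w. \<bar>w\<bar> > B \<Longrightarrow> wspace d N {w} = {0 :: 'k mpol}"
    using wspace_eq_zero_outside by blast
  \<comment> \<open>So many applications of \<open>Dstar d\<close> push the weight below -B, which
    starts the descent.\<close>
  have "wspace d N {w - 2 * int (nat (B + 1))} = {0 :: 'k mpol}"
    using w by (intro B) auto
  then show ?thesis
    using * Dstar_funpow_in_wspace[OF p] by blast
qed

lemma subspace_D_image: "mpol.subspace V \<Longrightarrow> mpol.subspace (D ` V)" for V :: "'k::field mpol set"
  unfolding D_def by (rule mpol_pair.linear_subspace_image[OF linear_derivation_of])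

text \<open>Induction on the nilpotency order $k$ of $D$ at $q$: the operator
  $D D^* - k (w + k - 1)$ lowers it, so $q$ lies in the image of $D$ up to the nonzero factor
  $k (w + k - 1)$.\<close>

lemma D_surjective_onto_positive_weight:
  fixes p :: "'k::field_char_0 mpol"
  assumes p: "p \<in> wspace d N {w}" and w: "w > 0"
  shows "p \<in> D ` wspace d N {w - 2}"
proof -
  let ?V = "D ` wspace d N {w - 2} :: 'k mpol set"
  have V: "mpol.subspace ?V"
    by (intro subspace_D_image subspace_mspan)
  have *: "q \<in> ?V" if "(D ^^ k) q = 0" "q \<in> wspace d N {w}" for k q
    using that
  proof (induction k arbitrary: q)
    case 0
    then show ?case using mpol.subspace_0[OF V] by simp
  next
    case (Suc k)
    define c where "c = (of_int (int (Suc k) * (w + int k)) :: 'k)"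
    have c: "c \<noteq> 0"
      using w unfolding c_def by (simp only: of_int_eq_0_iff) simp
    have "Dstar d q \<in> wspace d N {v. v + 2 \<in> {w}}"
      using Suc.prems by (intro Dstar_in_wspace)
    also have "{v. v + 2 \<in> {w}} = {w - 2}"
      by auto
    finally have q1: "D (Dstar d q) \<in> ?V"
      by blast
    moreover have "?V \<subseteq> wspace d N {w}"
      using D_in_wspace[of _ d N "{w - 2}"] by (auto simp: eq_diff_eq)
    ultimately have r: "D (Dstar d q) - smult_mpol c q \<in> wspace d N {w}" (is "?r \<in> _")
      using Suc.prems by (intro mpol.subspace_diff mpol.subspace_scale subspace_mspan) auto
    have lin: "(D ^^ k) (a - smult_mpol c b) = (D ^^ k) a - smult_mpol c ((D ^^ k) b)" for a b
    proof (induction k)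
      case (Suc k)
      have "D (x - smult_mpol c y) = D x - smult_mpol c (D y)" for x y
        using D_linear(1)[of "x - smult_mpol c y" "smult_mpol c y"] by (simp add: D_linear)
      with Suc show ?case by simp
    qed simp
    have "(D ^^ k) ?r = (D ^^ Suc k) (Dstar d q) - smult_mpol c ((D ^^ k) q)"
      by (simp add: lin funpow_swap1)
    also have "\<dots> = 0"
      unfolding D_funpow_Dstar[OF Suc.prems(2)] Suc.prems(1) c_def by (simp add: Dstar_linear)
    finally have "?r \<in> ?V"
      using Suc.IH r by blast
    then have "D (Dstar d q) - ?r \<in> ?V"
      using q1 mpol.subspace_diff[OF V] by blast
    then have "smult_mpol c q \<in> ?V"
      by simp
    then have "smult_mpol (inverse c) (smult_mpol c q) \<in> ?V"
      by (rule mpol.subspace_scale[OF V])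
    then show ?case
      using c by simp
  qed
  obtain B where B: "\<And>w. \<bar>w\<bar> > B \<Longrightarrow> wspace d N {w} = {0 :: 'k mpol}"
    using wspace_eq_zero_outside by blast
  \<comment> \<open>This bounds the nilpotency order of \<open>D\<close> at \<open>p\<close>: as
    \<open>w > 0\<close>, the iterates pass the weight \<open>B\<close>.\<close>
  have "wspace d N {w + 2 * int (nat (B + 1))} = {0 :: 'k mpol}"
    using w by (intro B) auto
  then show ?thesis
    using * D_funpow_in_wspace[OF p] p by blast
qed

text \<open>The bound -1 on the source weights makes every target weight positive, so each target
  power product is reached.\<close>

lemma D_image_wspace:
  assumes "A \<subseteq> {-1..}"
  shows "D ` wspace d N A = (wspace d N {w. w - 2 \<in> A} :: 'k::field_char_0 mpol set)"
proof
  show "wspace d N {w. w - 2 \<in> A} \<subseteq> (D ` wspace d N A :: 'k mpol set)"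
  proof (intro mspan_subset_subspace subspace_D_image subspace_mspan)
    fix m assume m: "m \<in> wmonos d N {w. w - 2 \<in> A}"
    then have "weight d m > 0" "{weight d m - 2} \<subseteq> A"
      using assms by (auto simp: wmonos_def)
    moreover have "(pp m :: 'k mpol) \<in> wspace d N {weight d m}"
      using m by (intro pp_in_mspan) (auto simp: wmonos_def)
    ultimately have "pp m \<in> (D ` wspace d N {weight d m - 2} :: 'k mpol set)"
      using D_surjective_onto_positive_weight by blast
    also have "\<dots> \<subseteq> D ` wspace d N A"
      using \<open>{weight d m - 2} \<subseteq> A\<close> by (intro image_mono mspan_mono wmonos_mono)
    finally show "pp m \<in> (D ` wspace d N A :: 'k mpol set)" .
  qed
qed (use D_in_wspace in blast)

section \<open>Kernels of \<open>D\<close> and the weights occurring in them\<close>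

lemma dim_D_kernel_wspace:
  assumes "A \<subseteq> {-1..}"
  shows "mpol.dim {p \<in> wspace d N A. D p = (0 :: 'k::field_char_0 mpol)} +
    card (wmonos d N {w. w - 2 \<in> A}) = card (wmonos d N A)"
proof -
  have "mpol.dim (wspace d N A :: 'k mpol set) =
      mpol.dim {p \<in> wspace d N A. D p = (0 :: 'k mpol)} + mpol.dim (D ` wspace d N A :: 'k mpol set)"
    using mpol_pair.dim_eq_dim_kernel_plus_dim_image[OF linear_derivation_of subspace_mspan,
        of "pp ` wmonos d N A" "wmonos d N A"]
    by (simp add: D_def finite_wmonos mspan_eq_span)
  then show ?thesis
    by (simp add: dim_mspan D_image_wspace[OF assms])
qed

text \<open>Keeping both supports inside \<open>keys p\<close> lets the parts inherit the degree and
  the variables of \<open>p\<close>.\<close>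

lemma mspan_decompose:
  obtains q r where "p = q + r" "q \<in> mspan (Poly_Mapping.keys p \<inter> S)"
    "r \<in> mspan (Poly_Mapping.keys p - S)"
    "\<And>m. m \<in> S \<Longrightarrow> Poly_Mapping.lookup q m = Poly_Mapping.lookup p m"
proof
  let ?s = "\<lambda>M. \<Sum>m\<in>M. Poly_Mapping.single m (Poly_Mapping.lookup p m)"
  have lookup: "Poly_Mapping.lookup (?s M) m = (if m \<in> M then Poly_Mapping.lookup p m else 0)"
    if "finite M" for M m
    using that by (simp add: lookup_sum lookup_single when_def)
  show "p = ?s (Poly_Mapping.keys p \<inter> S) + ?s (Poly_Mapping.keys p - S)"
    by (intro poly_mapping_eqI) (auto simp: lookup lookup_add in_keys_iff)
qed (auto simp: mspan_iff lookup_sum lookup_single when_def in_keys_iff)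

text \<open>\<open>D\<close> shifts all weights equally, so the kernel is spanned by its weight
  components, and those of negative weight vanish by injectivity.\<close>

lemma D_kernel_nonneg_weight:
  assumes p: "p \<in> wspace d N UNIV" and D0: "D p = (0 :: 'k::field_char_0 mpol)"
  shows "p \<in> wspace d N {0..}"
proof -
  have "Poly_Mapping.lookup p m = 0" if m: "weight d m < 0" for m
  proof -
    let ?w = "weight d m"
    obtain q r where qr: "p = q + r" "q \<in> mspan (Poly_Mapping.keys p \<inter> {m. weight d m = ?w})"
      "r \<in> mspan (Poly_Mapping.keys p - {m. weight d m = ?w})"
      and q: "\<And>m'. m' \<in> {m. weight d m = ?w} \<Longrightarrow>
        Poly_Mapping.lookup q m' = Poly_Mapping.lookup p m'"
      using mspan_decompose[of p "{m. weight d m = ?w}"] by blast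
    have q1: "q \<in> wspace d N {?w}" and r1: "r \<in> wspace d N (- {?w})"
      using qr(2,3) p by (auto simp: mspan_def wmonos_def)
    have "D q \<in> wspace d N {v. v - 2 \<in> {?w}}"
      by (rule D_in_wspace[OF q1])
    \<comment> \<open>The two sides are supported on disjoint sets of weights, so both are
      0.\<close>
    moreover have "D q = - D r"
      using D0 qr(1) by (simp add: D_linear eq_neg_iff_add_eq_0)
    then have "D q \<in> wspace d N {v. v - 2 \<in> - {?w}}"
      using D_in_wspace[OF r1] mpol.subspace_neg[OF subspace_mspan] by metis
    ultimately have "D q = 0"
      by (intro poly_mapping_eqI) (auto simp: mspan_iff wmonos_def)
    then have "q = 0"
      using D_injective_on_negative_weight[OF q1 m] by blast
    then show ?thesis
      using q by fastforce
  qed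
  then show ?thesis
    using p by (force simp: mspan_iff wmonos_def)
qed

lemma homog_poly_alg: "homog_part N (poly_alg d) = wspace d N UNIV"
  by (auto simp: homog_part_def poly_alg_def mspan_def wmonos_def)

text \<open>Discarding the negative weights brings the kernel into the range where
  \<open>dim_D_kernel_wspace\<close> applies.\<close>

lemma homog_semi_invariants:
  "homog_part N (semi_invariants d) = {p \<in> wspace d N {0..}. D p = (0 :: 'k::field_char_0 mpol)}"
proof -
  have "homog_part N (semi_invariants d) = {p \<in> wspace d N UNIV. D p = (0 :: 'k mpol)}"
    unfolding homog_poly_alg[symmetric] by (auto simp: homog_part_def semi_invariants_def)
  also have "\<dots> = {p \<in> wspace d N {0..}. D p = 0}"
    using D_kernel_nonneg_weight mspan_mono[OF wmonos_mono[OF subset_UNIV]] by blast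
  finally show ?thesis .
qed

text \<open>If both derivations kill \<open>p\<close>, so does their commutator, which forces weight
  0. Conversely, for \<open>p\<close> of weight 0 in the kernel of \<open>D\<close>,
  \<open>Dstar d p\<close> has weight -2 and is killed by \<open>D\<close>, hence is 0.\<close>

lemma homog_invariants:
  "homog_part N (invariants d) = {p \<in> wspace d N {0}. D p = (0 :: 'k::field_char_0 mpol)}"
proof -
  have "homog_part N (invariants d) =
      {p \<in> wspace d N UNIV. D p = (0 :: 'k mpol) \<and> Dstar d p = 0}"
    unfolding homog_poly_alg[symmetric] by (auto simp: homog_part_def invariants_def)
  also have "\<dots> = {p \<in> wspace d N {0}. D p = 0}"
  proof safe
    fix p :: "'k mpol" assume p: "p \<in> wspace d N UNIV" and D0: "D p = 0" "Dstar d p = 0"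
    let ?f = "\<lambda>(k, i). int (d ! k) - 2 * int i"
    let ?H = "derivation_of (\<lambda>v. smult_mpol (of_int (?f v)) (X v)) p"
    have "?H = 0"
      using D_Dstar_commutator_derivation[of p d] D0 p wspace_subset_poly_alg
      by (auto simp: D_linear Dstar_linear case_prod_unfold)
    moreover have "?H = (\<Sum>m\<in>Poly_Mapping.keys p. smult_mpol (Poly_Mapping.lookup p m)
        (derivation_of (\<lambda>v. smult_mpol (of_int (?f v)) (X v)) (pp m)))"
      by (simp add: derivation_of_def derivation_of_single)
    ultimately have "(\<Sum>m\<in>Poly_Mapping.keys p.
        smult_mpol (Poly_Mapping.lookup p m) (smult_mpol (of_int (weight d m)) (pp m))) = 0"
      unfolding derivation_of_weight weight_def by simp
    then have *: "Poly_Mapping.lookup (\<Sum>m\<in>Poly_Mapping.keys p. smult_mpol (Poly_Mapping.lookup p m)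
        (smult_mpol (of_int (weight d m)) (pp m))) m = 0" for m
      by simp
    \<comment> \<open>Characteristic 0 enters here: a nonzero integer weight stays nonzero in the
      field.\<close>
    have "Poly_Mapping.lookup p m = 0 \<or> weight d m = 0" for m
      using *[of m]
      by (simp add: lookup_sum lookup_smult_mpol lookup_single when_def in_keys_iff
          if_distrib[where f = "(*) _"] cong: if_cong split: if_splits)
    then show "p \<in> wspace d N {0}"
      using p by (force simp: mspan_iff wmonos_def)
  next
    fix p :: "'k mpol" assume p: "p \<in> wspace d N {0}" and D0: "D p = 0"
    show "p \<in> wspace d N UNIV"
      using p mspan_mono[OF wmonos_mono[OF subset_UNIV]] by blast
    have "Dstar d p \<in> wspace d N {v. v + 2 \<in> {0}}"
      by (rule Dstar_in_wspace[OF p])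
    also have "{v. v + 2 \<in> {0}} = {-2 :: int}"
      by auto
    finally have "Dstar d p \<in> wspace d N {-2}" .
    moreover have "D (Dstar d p) = 0"
      using D_Dstar_commutator[OF p] D0 by (simp add: Dstar_linear)
    ultimately show "Dstar d p = 0"
      using D_injective_on_negative_weight by fastforce
  qed
  finally show ?thesis .
qed

subsection \<open>Cayley--Sylvester formulas\<close>

text \<open>On nonnegative weights the image of \<open>D\<close> accounts for all weights at least
  2, leaving 0 and 1.\<close>

lemma dim_semi_invariants:
  "mpol.dim (homog_part N (semi_invariants d) :: 'k::field_char_0 mpol set) =
    card (wmonos d N {0, 1})"
proof -
  have "wmonos d N {0..} = wmonos d N {w. w - 2 \<in> {0..}} \<union> wmonos d N {0, 1}"
    by (auto simp: wmonos_def)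
  moreover have "wmonos d N {w. w - 2 \<in> {0..}} \<inter> wmonos d N {0, 1} = {}"
    by (auto simp: wmonos_def)
  ultimately have "card (wmonos d N {0..}) =
      card (wmonos d N {w. w - 2 \<in> {0..}}) + card (wmonos d N {0, 1})"
    using card_Un_disjoint finite_wmonos by metis
  then show ?thesis
    using dim_D_kernel_wspace[of "{0..}" d N, where 'k = 'k] by (simp add: homog_semi_invariants)
qed

text \<open>Stated additively to avoid truncated subtraction.\<close>

lemma dim_invariants:
  "mpol.dim (homog_part N (invariants d) :: 'k::field_char_0 mpol set) + card (wmonos d N {2}) =
    card (wmonos d N {0})"
  using dim_D_kernel_wspace[of "{0}" d N, where 'k = 'k]
  by (simp add: homog_invariants)

subsection \<open>Coefficients of the right-hand sides\<close>

lemma fps_nth_higher_deriv: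
  "((fps_deriv ^^ j) f) $ m = pochhammer (of_nat (m + 1)) j * f $ (m + j)"
  for f :: "'a::comm_ring_1 fps"
proof (induction j arbitrary: m)
  case (Suc j)
  have "((fps_deriv ^^ Suc j) f) $ m = of_nat (m + 1) * (((fps_deriv ^^ j) f) $ (m + 1))"
    by simp
  also have "\<dots> = pochhammer (of_nat (m + 1)) (Suc j) * f $ (m + Suc j)"
    by (simp only: Suc pochhammer_rec) (simp add: algebra_simps)
  finally show ?case .
qed simp

text \<open>Both sides equal (n + i + b - 1)! / ((n - 1)! b!).\<close>

lemma pochhammer_binomial:
  assumes "n \<ge> 1"
  shows "pochhammer (of_nat n) i * of_nat ((n + i + b - 1) choose b) =
    (fact i * of_nat ((i + b) choose i) * of_nat ((n + (i + b) - 1) choose (i + b)) :: 'a::field_char_0)"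
proof -
  have p: "pochhammer (of_nat n) i = (fact (n + i - 1) / fact (n - 1) :: 'a)"
  proof -
    have "(1 + of_nat (n - 1) :: 'a) = of_nat n"
      using assms by (simp add: of_nat_diff)
    then have "(fact (n - 1 + i) :: 'a) = fact (n - 1) * pochhammer (of_nat n) i"
      using pochhammer_product'[of "1 :: 'a" "n - 1" i] by (simp only: pochhammer_fact)
    then show ?thesis
      using assms by simp
  qed
  have 1: "of_nat ((n + i + b - 1) choose b) = (fact (n + i + b - 1) / (fact b * fact (n + i - 1)) :: 'a)"
    using assms binomial_fact[of b "n + i + b - 1", where 'a = 'a] by simp
  have 2: "of_nat ((i + b) choose i) = (fact (i + b) / (fact i * fact b) :: 'a)"
    using binomial_fact[of i "i + b", where 'a = 'a] by simp
  have 3: "of_nat ((n + (i + b) - 1) choose (i + b)) =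
      (fact (n + i + b - 1) / (fact (i + b) * fact (n - 1)) :: 'a)"
    using assms binomial_fact[of "i + b" "n + (i + b) - 1", where 'a = 'a] by (simp add: add.assoc)
  show ?thesis
    unfolding p 1 2 3 by (simp add: field_simps)
qed

text \<open>The coefficient of (t - 1)^i in the expansion of (1 - t z)^(-n) at t = 1, obtained by
  expanding each t^a binomially.\<close>

definition mset_series :: "nat \<Rightarrow> nat \<Rightarrow> rat fps" where
  "mset_series n i = Abs_fps (\<lambda>a. of_nat (a choose i) * of_nat ((n + a - 1) choose a))"

text \<open>Closed form of this Taylor coefficient: the i-th derivative of (1 - t z)^(-n) at t = 1
  is (n)_i z^i (1 - z)^(-n-i).\<close>

lemma mset_series_eq:
  assumes "n \<ge> 1"
  shows "fps_const (pochhammer (of_nat n) i) * fps_X ^ i * inverse ((1 - fps_X) ^ (n + i)) =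
    fps_const (fact i) * mset_series n i"
proof -
  have "inverse ((1 - fps_X) ^ (n + i) :: rat fps) = Abs_fps (\<lambda>b. of_nat ((n + i + b - 1) choose b))"
    using one_minus_const_fps_X_neg_power'[of "n + i" "1 :: rat"] assms by simp
  then show ?thesis
    using pochhammer_binomial[OF assms, where 'a = rat, of i]
    by (intro fps_ext) (auto simp: mset_series_def mult.assoc fps_X_power_mult_nth not_less le_iff_add add.assoc)
qed

lemma mset_series_compose_eq:
  assumes "n \<ge> 1"
  shows "fps_const (pochhammer (of_nat n) i) * fps_X ^ (2 * i) * inverse ((1 - fps_X ^ 2) ^ (n + i)) =
    fps_const (fact i) * (mset_series n i oo fps_X ^ 2)"
proof -
  have "(fps_const (pochhammer (of_nat n) i) * fps_X ^ i * inverse ((1 - fps_X) ^ (n + i))) oo fps_X ^ 2 =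
      (fps_const (fact i) * mset_series n i) oo (fps_X ^ 2 :: rat fps)"
    using mset_series_eq[OF assms] by simp
  then show ?thesis
    by (simp add: fps_compose_mult_distrib fps_inverse_compose fps_compose_sub_distrib
        flip: fps_compose_power power_mult)
qed

text \<open>The coefficient of $(t - 1)^j$ in the expansion of $((1 - t z)(1 - t z^2))^{-n}$ at $t = 1$.\<close>

definition taylor_series :: "nat \<Rightarrow> nat \<Rightarrow> rat fps" where
  "taylor_series n j = (\<Sum>i\<le>j. mset_series n i * (mset_series n (j - i) oo fps_X ^ 2))"

text \<open>The index \<open>s\<close> is the part of the exponent contributed by z^2. Vandermonde's
  identity merges the expansions of the two powers of t into that of t^(r - s/2).\<close>

lemma taylor_series_nth:
  "taylor_series n j $ r = (\<Sum>s\<in>{s. s \<le> r \<and> even s}.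
    of_nat ((n + (r - s) - 1) choose (r - s)) * of_nat ((n + s div 2 - 1) choose (s div 2)) *
      of_nat ((r - s div 2) choose j))"
proof -
  have "taylor_series n j $ r = (\<Sum>i\<le>j. \<Sum>s\<in>{..r}.
      (mset_series n (j - i) oo fps_X ^ 2) $ s * mset_series n i $ (r - s))"
    unfolding taylor_series_def fps_sum_nth
    by (subst mult.commute) (simp add: fps_mult_nth atLeast0AtMost)
  also have "\<dots> = (\<Sum>s\<in>{..r}. \<Sum>i\<le>j.
      (mset_series n (j - i) oo fps_X ^ 2) $ s * mset_series n i $ (r - s))"
    by (rule sum.swap)
  also have "\<dots> = (\<Sum>s\<in>{s. s \<le> r \<and> even s}. \<Sum>i\<le>j.
      (mset_series n (j - i) oo fps_X ^ 2) $ s * mset_series n i $ (r - s))"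
    by (intro sum.mono_neutral_right) (auto simp: fps_nth_compose_X_power)
  also have "\<dots> = (\<Sum>s\<in>{s. s \<le> r \<and> even s}.
    of_nat ((n + (r - s) - 1) choose (r - s)) * of_nat ((n + s div 2 - 1) choose (s div 2)) *
      of_nat ((r - s div 2) choose j))"
  proof (intro sum.cong refl)
    fix s assume s: "s \<in> {s. s \<le> r \<and> even s}"
    have "r - s + s div 2 = r - s div 2"
      using s by auto
    then have "(\<Sum>i\<le>j. (of_nat ((r - s) choose i) * of_nat ((s div 2) choose (j - i)) :: rat)) =
        of_nat ((r - s div 2) choose j)"
      using vandermonde[of "r - s" "s div 2" j] by (simp flip: of_nat_mult of_nat_sum)
    then show "(\<Sum>i\<le>j. (mset_series n (j - i) oo fps_X ^ 2) $ s * mset_series n i $ (r - s)) =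
      of_nat ((n + (r - s) - 1) choose (r - s)) * of_nat ((n + s div 2 - 1) choose (s div 2)) *
      of_nat ((r - s div 2) choose j)"
      using s by (simp add: fps_nth_compose_X_power mset_series_def sum_distrib_left mult_ac
          flip: \<open>(\<Sum>i\<le>j. of_nat ((r - s) choose i) * of_nat ((s div 2) choose (j - i))) = _\<close>)
  qed
  finally show ?thesis .
qed

text \<open>The parameter \<open>q\<close> covers both formulas: 1 - z for the invariants and 1 for
  the semi-invariants.\<close>

lemma summand_eq_taylor_series:
  assumes "n \<ge> 1" "k \<in> {1..n}"
  shows "(\<Sum>i=0..n - k. of_nat ((n - k) choose i) *
      fps_const (pochhammer (of_nat n) i * pochhammer (of_nat n) (n - k - i)) *
      q * fps_X ^ (2 * n - k - i - 1) /
      ((1 - fps_X) ^ (n + i) * (1 - fps_X ^ 2) ^ (2 * n - k - i))) =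
    fps_const (fact (n - k)) * (fps_X ^ (k - 1) * (q * taylor_series n (n - k)))"
proof -
  let ?j = "n - k"
  have "of_nat (?j choose i) *
      fps_const (pochhammer (of_nat n) i * pochhammer (of_nat n) (?j - i)) *
      q * fps_X ^ (2 * n - k - i - 1) /
      ((1 - fps_X) ^ (n + i) * (1 - fps_X ^ 2) ^ (2 * n - k - i)) =
    fps_const (fact ?j) * (fps_X ^ (k - 1) *
      (q * (mset_series n i * (mset_series n (?j - i) oo fps_X ^ 2))))" if i: "i \<in> {0..?j}" for i
  proof -
    \<comment> \<open>The power of z splits into z^(k - 1), to be absorbed by the derivative, and
      the powers that belong to the two denominators.\<close>
    have e: "2 * n - k - i = n + (?j - i)" "2 * n - k - i - 1 = (k - 1) + (i + 2 * (?j - i))"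
      using i assms by auto
    have "(((1 - fps_X) ^ (n + i) * (1 - fps_X ^ 2) ^ (n + (?j - i))) :: rat fps) $ 0 \<noteq> 0"
      by (simp add: fps_power_zeroth)
    then have "of_nat (?j choose i) *
        fps_const (pochhammer (of_nat n) i * pochhammer (of_nat n) (?j - i)) *
        q * fps_X ^ (2 * n - k - i - 1) /
        ((1 - fps_X) ^ (n + i) * (1 - fps_X ^ 2) ^ (2 * n - k - i)) =
      of_nat (?j choose i) *
        fps_const (pochhammer (of_nat n) i * pochhammer (of_nat n) (?j - i)) *
        q * fps_X ^ ((k - 1) + (i + 2 * (?j - i))) *
        inverse ((1 - fps_X) ^ (n + i) * (1 - fps_X ^ 2) ^ (n + (?j - i)))"
      unfolding e(2) unfolding e(1) by (rule fps_divide_unit)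
    also have "\<dots> = of_nat (?j choose i) * fps_X ^ (k - 1) * q *
        (fps_const (pochhammer (of_nat n) i) * fps_X ^ i * inverse ((1 - fps_X) ^ (n + i))) *
        (fps_const (pochhammer (of_nat n) (?j - i)) * fps_X ^ (2 * (?j - i)) *
          inverse ((1 - fps_X ^ 2) ^ (n + (?j - i))))"
      unfolding power_add[of fps_X] fps_inverse_mult fps_const_mult[symmetric]
      by (simp only: mult_ac)
    also have "\<dots> = of_nat (?j choose i) * (fps_const (fact i) * fps_const (fact (?j - i))) *
        (fps_X ^ (k - 1) * (q * (mset_series n i * (mset_series n (?j - i) oo fps_X ^ 2))))"
      unfolding mset_series_eq[OF assms(1)] mset_series_compose_eq[OF assms(1)]
      by (simp only: mult_ac)
    also have "of_nat (?j choose i) * (fps_const (fact i) * fps_const (fact (?j - i))) =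
        (fps_const (fact ?j) :: rat fps)"
    proof -
      have "of_nat (?j choose i) * (fact i * fact (?j - i)) = (fact ?j :: rat)"
        using i binomial_fact[of i ?j, where 'a = rat] by simp
      then show ?thesis
        by (simp only: fps_of_nat[symmetric] fps_const_mult)
    qed
    finally show ?thesis .
  qed
  then have "(\<Sum>i=0..?j. of_nat (?j choose i) *
      fps_const (pochhammer (of_nat n) i * pochhammer (of_nat n) (?j - i)) *
      q * fps_X ^ (2 * n - k - i - 1) /
      ((1 - fps_X) ^ (n + i) * (1 - fps_X ^ 2) ^ (2 * n - k - i))) =
    (\<Sum>i=0..?j. fps_const (fact ?j) * (fps_X ^ (k - 1) *
      (q * (mset_series n i * (mset_series n (?j - i) oo fps_X ^ 2)))))"
    by (rule sum.cong[OF refl])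
  then show ?thesis
    by (simp only: taylor_series_def sum_distrib_left atLeast0AtMost)
qed

text \<open>Both sides are the coefficient of t^m in t^p (1 - t)^(-n): expand t^p in powers of t -
  1; the terms of order at least n give a polynomial of degree below m. The proof uses Vandermonde's
  identity for generalised binomials instead.\<close>

lemma alternating_binomial_sum:
  assumes "n \<ge> 1" "p \<le> m"
  shows "(\<Sum>k=1..n. (- 1) ^ (n - k) * of_nat ((m + k - 1) choose (k - 1)) * of_nat (p choose (n - k))) =
    (of_nat ((n + (m - p) - 1) choose (m - p)) :: rat)"
proof -
  \<comment> \<open>Upper negation absorbs the alternating signs and makes the sum a Vandermonde
    convolution with upper indices -(m + 1) and p.\<close>
  have c: "of_nat ((m + l) choose l) = (- 1) ^ l * ((- of_nat (m + 1)) gchoose l :: rat)" for l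
  proof -
    have "(- of_nat (m + 1) :: rat) gchoose l = (- 1) ^ l * ((of_nat (m + 1) + of_nat l - 1) gchoose l)"
      by (rule gbinomial_minus)
    also have "(of_nat (m + 1) + of_nat l - 1 :: rat) = of_nat (m + l)"
      by simp
    finally show ?thesis
      by (simp add: binomial_gbinomial flip: power_mult_distrib mult.assoc)
  qed
  have "(\<Sum>k=1..n. (- 1) ^ (n - k) * of_nat ((m + k - 1) choose (k - 1)) * of_nat (p choose (n - k))) =
    (\<Sum>l=0..n - 1. (- 1) ^ (n - 1 - l) * of_nat ((m + l) choose l) * (of_nat (p choose (n - 1 - l)) :: rat))"
    using assms(1) by (intro sum.reindex_bij_witness[of _ Suc "\<lambda>k. k - 1"]) auto
  also have "\<dots> = (\<Sum>l=0..n - 1. (- 1) ^ (n - 1) *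
      (((- of_nat (m + 1)) gchoose l) * ((of_nat p :: rat) gchoose (n - 1 - l))))"
  proof (intro sum.cong refl)
    fix l assume "l \<in> {0..n - 1}"
    then have "n - 1 = (n - 1 - l) + l"
      by simp
    then have "(- 1) ^ (n - 1) = (- 1 :: rat) ^ (n - 1 - l) * (- 1) ^ l"
      using power_add[of "- 1 :: rat" "n - 1 - l" l] by simp
    then show "(- 1) ^ (n - 1 - l) * of_nat ((m + l) choose l) * (of_nat (p choose (n - 1 - l)) :: rat) =
        (- 1) ^ (n - 1) * (((- of_nat (m + 1)) gchoose l) * (of_nat p gchoose (n - 1 - l)))"
      unfolding c by (simp only: binomial_gbinomial mult_ac)
  qed
  also have "\<dots> = (- 1) ^ (n - 1) * ((- of_nat (m + 1) + of_nat p :: rat) gchoose (n - 1))"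
    by (simp only: gbinomial_Vandermonde sum_distrib_left[symmetric])
  also have "(- of_nat (m + 1) + of_nat p :: rat) = - of_nat (m - p + 1)"
    using assms(2) by (simp add: of_nat_diff)
  also have "(- 1) ^ (n - 1) * ((- of_nat (m - p + 1) :: rat) gchoose (n - 1)) =
      (of_nat (m - p + 1) + of_nat (n - 1) - 1) gchoose (n - 1)"
    unfolding gbinomial_minus by (simp flip: power_mult_distrib mult.assoc)
  also have "(of_nat (m - p + 1) + of_nat (n - 1) - 1 :: rat) = of_nat (m - p + (n - 1))"
    by simp
  also have "(of_nat (m - p + (n - 1)) :: rat) gchoose (n - 1) = of_nat ((m - p + (n - 1)) choose (n - 1))"
    by (simp add: binomial_gbinomial)
  also have "(m - p + (n - 1)) choose (n - 1) = (n + (m - p) - 1) choose (m - p)"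
    using assms(1) binomial_symmetric[of "m - p" "m - p + (n - 1)"] by (simp add: add.commute)
  finally show ?thesis .
qed

text \<open>The coefficient of $t^m z^r$ in $((1 - t)(1 - t z)(1 - t z^2))^{-n}$, for $r \<le> m$; the summation
  index $s$ is twice the exponent of $t z^2$.\<close>

definition tcount :: "nat \<Rightarrow> nat \<Rightarrow> nat \<Rightarrow> nat" where
  "tcount n m r = (\<Sum>s\<in>{s. s \<le> r \<and> even s}.
    ((n + (r - s) - 1) choose (r - s)) * ((n + s div 2 - 1) choose (s div 2)) *
      ((n + (m - (r - s div 2)) - 1) choose (m - (r - s div 2))))"

text \<open>For each \<open>s\<close>, \<open>alternating_binomial_sum\<close> applies with p = r -
  s/2, which is at most m because \<open>r \<le> m\<close>.\<close>

lemma taylor_series_sum: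
  assumes "n \<ge> 1" "r \<le> m"
  shows "(\<Sum>k=1..n. (- 1) ^ (n - k) * of_nat ((m + k - 1) choose (k - 1)) * taylor_series n (n - k) $ r) =
    of_nat (tcount n m r)"
proof -
  let ?c = "\<lambda>s. of_nat ((n + (r - s) - 1) choose (r - s)) * of_nat ((n + s div 2 - 1) choose (s div 2)) :: rat"
  have "(\<Sum>k=1..n. (- 1) ^ (n - k) * of_nat ((m + k - 1) choose (k - 1)) * taylor_series n (n - k) $ r) =
    (\<Sum>k=1..n. \<Sum>s\<in>{s. s \<le> r \<and> even s}. ?c s * ((- 1) ^ (n - k) *
      of_nat ((m + k - 1) choose (k - 1)) * of_nat ((r - s div 2) choose (n - k))))"
    unfolding taylor_series_nth by (simp add: sum_distrib_left mult_ac)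
  also have "\<dots> = (\<Sum>s\<in>{s. s \<le> r \<and> even s}. ?c s * (\<Sum>k=1..n. (- 1) ^ (n - k) *
      of_nat ((m + k - 1) choose (k - 1)) * of_nat ((r - s div 2) choose (n - k))))"
    by (subst sum.swap) (simp add: sum_distrib_left)
  also have "\<dots> = of_nat (tcount n m r)"
    unfolding tcount_def of_nat_sum of_nat_mult
    using assms by (intro sum.cong refl, subst alternating_binomial_sum) auto
  finally show ?thesis .
qed

text \<open>The derivative of order k - 1 undoes the shift by z^(k - 1) and leaves (m + 1)...(m + k
  - 1) as a factor; the prefactor cancels both factorials.\<close>

lemma formula_nth:
  assumes "n \<ge> 1"
  shows "(\<Sum>k=1..n. fps_const ((-1) ^ (n - k) / (fact (n - k) * fact (k - 1))) *
        (fps_deriv ^^ (k - 1))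
          (\<Sum>i=0..n - k.
            of_nat ((n - k) choose i) *
            fps_const (pochhammer (of_nat n) i * pochhammer (of_nat n) (n - k - i)) *
            q * fps_X ^ (2 * n - k - i - 1) /
            ((1 - fps_X) ^ (n + i) * (1 - fps_X ^ 2) ^ (2 * n - k - i)))) $ m =
    (\<Sum>k=1..n. (- 1) ^ (n - k) * of_nat ((m + k - 1) choose (k - 1)) *
      (q * taylor_series n (n - k)) $ m)"
  unfolding fps_sum_nth
proof (rule sum.cong[OF refl])
  fix k assume k: "k \<in> {1..n}"
  have "pochhammer (of_nat (m + 1)) (k - 1) = (fact (k - 1) * of_nat ((m + k - 1) choose (k - 1)) :: rat)"
  proof -
    have "of_nat (m + (k - 1)) - of_nat (k - 1) + 1 = (of_nat (m + 1) :: rat)"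
      by simp
    then have "of_nat ((m + (k - 1)) choose (k - 1)) = (pochhammer (of_nat (m + 1)) (k - 1) / fact (k - 1) :: rat)"
      unfolding binomial_gbinomial gbinomial_pochhammer' by (simp add: add.commute)
    then show ?thesis
      using k by simp
  qed
  then show "(fps_const ((- 1) ^ (n - k) / (fact (n - k) * fact (k - 1))) *
      (fps_deriv ^^ (k - 1))
        (\<Sum>i=0..n - k. of_nat ((n - k) choose i) *
          fps_const (pochhammer (of_nat n) i * pochhammer (of_nat n) (n - k - i)) *
          q * fps_X ^ (2 * n - k - i - 1) /
          ((1 - fps_X) ^ (n + i) * (1 - fps_X ^ 2) ^ (2 * n - k - i)))) $ m =
    (- 1) ^ (n - k) * of_nat ((m + k - 1) choose (k - 1)) * (q * taylor_series n (n - k)) $ m"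
    unfolding summand_eq_taylor_series[OF assms k]
    by (simp add: fps_nth_higher_deriv fps_X_power_mult_nth)
qed

subsection \<open>Counting power products for $d = (2, \ldots, 2)$\<close>

text \<open>Lists are used because \<open>card_length_sum_list\<close> counts them by length and
  sum.\<close>

definition row :: "nat \<Rightarrow> nat \<Rightarrow> (var \<Rightarrow>\<^sub>0 nat) \<Rightarrow> nat list" where
  "row n i m = map (\<lambda>k. Poly_Mapping.lookup m (k, i)) [0..<n]"

lemma vars_of_quadratic: "vars_of (replicate n 2) = {..<n} \<times> {0, 1, 2}"
  by (auto simp: vars_of_def)

lemma grading_quadratic:
  assumes "Poly_Mapping.keys m \<subseteq> vars_of (replicate n 2)"
  shows "grading f m = (\<Sum>k<n. of_nat (Poly_Mapping.lookup m (k, 0)) * f (k, 0) +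
    of_nat (Poly_Mapping.lookup m (k, 1)) * f (k, 1) + of_nat (Poly_Mapping.lookup m (k, 2)) * f (k, 2))"
  using assms
  by (simp add: grading_superset[OF finite_vars_of assms] vars_of_quadratic add.assoc
      sum.cartesian_product')

lemma sum_list_row: "int (sum_list (row n i m)) = (\<Sum>k<n. int (Poly_Mapping.lookup m (k, i)))"
  by (simp add: row_def interv_sum_list_conv_sum_set_nat lessThan_atLeast0)

lemma mdeg_quadratic:
  assumes "Poly_Mapping.keys m \<subseteq> vars_of (replicate n 2)"
  shows "mdeg m = sum_list (row n 0 m) + sum_list (row n 1 m) + sum_list (row n 2 m)"
proof -
  have "int (mdeg m) = int (sum_list (row n 0 m) + sum_list (row n 1 m) + sum_list (row n 2 m))"
    by (simp add: mdeg_eq_grading grading_quadratic[OF assms] sum_list_row sum.distrib)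
  then show ?thesis by linarith
qed

lemma weight_quadratic:
  assumes "Poly_Mapping.keys m \<subseteq> vars_of (replicate n 2)"
  shows "weight (replicate n 2) m = 2 * (int (sum_list (row n 0 m)) - int (sum_list (row n 2 m)))"
  by (simp add: weight_def grading_quadratic[OF assms] sum_list_row sum_distrib_left
      right_diff_distrib mult.commute sum_subtractf[symmetric])

text \<open>Row sums a0, a1, a2 satisfy a0 + a1 + a2 = N and a0 - a2 = N - r, that is, a1 + 2 a2 =
  r. With s = 2 a2 this gives a1 = r - s and a0 = N - (r - s/2).\<close>

lemma bij_betw_rows:
  assumes "r \<le> N"
  shows "bij_betw (\<lambda>m. (2 * sum_list (row n 2 m), row n 1 m, row n 2 m, row n 0 m))
    (wmonos (replicate n 2) N {2 * (int N - int r)})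
    (SIGMA s:{s. s \<le> r \<and> even s}. {l. length l = n \<and> sum_list l = r - s} \<times>
      {l. length l = n \<and> sum_list l = s div 2} \<times>
      {l. length l = n \<and> sum_list l = N - (r - s div 2)})"
    (is "bij_betw ?f ?M ?S")
proof (rule bij_betw_imageI)
  have lookup_row: "Poly_Mapping.lookup m (k, i) = row n i m ! k" if "k < n" for k i m
    using that by (simp add: row_def)
  show "inj_on ?f ?M"
  proof (intro inj_onI poly_mapping_eqI)
    fix m m' v assume *: "m \<in> ?M" "m' \<in> ?M" "?f m = ?f m'"
    show "Poly_Mapping.lookup m v = Poly_Mapping.lookup m' v"
    proof (cases "v \<in> vars_of (replicate n 2)")
      case True
      then show ?thesis
        using *(3) by (auto simp: vars_of_quadratic lookup_row simp del: One_nat_def)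
    next
      case False
      then have "v \<notin> Poly_Mapping.keys m" "v \<notin> Poly_Mapping.keys m'"
        using * by (auto simp: wmonos_def)
      then show ?thesis
        by (simp add: in_keys_iff)
    qed
  qed
  show "?f ` ?M = ?S"
  proof (intro equalityI subsetI)
    fix x assume "x \<in> ?f ` ?M"
    then obtain m where m: "m \<in> ?M" and x: "x = ?f m"
      by blast
    have keys: "Poly_Mapping.keys m \<subseteq> vars_of (replicate n 2)"
      using m by (simp add: wmonos_def)
    have len: "length (row n i m) = n" for i
      by (simp add: row_def)
    have N: "sum_list (row n 0 m) + sum_list (row n 1 m) + sum_list (row n 2 m) = N"
      and w: "2 * (int (sum_list (row n 0 m)) - int (sum_list (row n 2 m))) = 2 * (int N - int r)"
      using m unfolding mdeg_quadratic[OF keys, symmetric] weight_quadratic[OF keys, symmetric]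
      by (auto simp: wmonos_def)
    have 1: "sum_list (row n 1 m) + 2 * sum_list (row n 2 m) = r"
      using N w by presburger
    then have "sum_list (row n 0 m) = N - (r - sum_list (row n 2 m))"
      using N by linarith
    with 1 show "x \<in> ?S"
      unfolding x by (auto simp: len)
  next
    fix x assume "x \<in> ?S"
    then obtain l0 l1 l2 where x: "x = (2 * sum_list l2, l1, l2, l0)"
      and len: "length l0 = n" "length l1 = n" "length l2 = n"
      and sums: "2 * sum_list l2 \<le> r" "sum_list l1 = r - 2 * sum_list l2"
        "sum_list l0 = N - (r - sum_list l2)"
      by (auto elim!: evenE)
    \<comment> \<open>The inverse map: the exponent function with the prescribed rows, extended by
      0.\<close>
    define g where "g = (\<lambda>(k, i). if k < n \<and> i \<le> 2 then [l0, l1, l2] ! i ! k else (0 :: nat))"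
    define m where "m = Abs_poly_mapping g"
    have "{v. g v \<noteq> 0} \<subseteq> {..<n} \<times> {..2}"
      by (auto simp: g_def split: if_splits)
    then have "finite {v. g v \<noteq> 0}"
      by (rule finite_subset) simp
    then have g: "Poly_Mapping.lookup m = g"
      by (simp add: m_def)
    have rows: "row n 0 m = l0" "row n 1 m = l1" "row n 2 m = l2"
      using len by (auto simp: row_def g g_def intro!: nth_equalityI)
    have keys: "Poly_Mapping.keys m \<subseteq> vars_of (replicate n 2)"
      by (auto simp: in_keys_iff g g_def vars_of_def split: if_splits)
    have "m \<in> ?M"
      using keys sums assms mdeg_quadratic[OF keys] weight_quadratic[OF keys]
      unfolding rows by (simp add: wmonos_def)
    moreover have "?f m = x"
      by (simp only: rows x)
    ultimately show "x \<in> ?f ` ?M"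
      by blast
  qed
qed

text \<open>Stars and bars in each of the three rows.\<close>

lemma card_wmonos_quadratic:
  assumes "r \<le> N"
  shows "card (wmonos (replicate n 2) N {2 * (int N - int r)}) = tcount n N r"
proof -
  have card: "card {l :: nat list. length l = n \<and> sum_list l = s} = (n + s - 1) choose s" for s
    by (simp add: card_length_sum_list add.commute)
  have fin: "finite {l :: nat list. length l = n \<and> sum_list l = s}" for s
    by (rule finite_subset[OF _ finite_lists_length_eq[of "{..s}" n]]) (auto intro: member_le_sum_list)
  have "card (wmonos (replicate n 2) N {2 * (int N - int r)}) =
    card (SIGMA s:{s. s \<le> r \<and> even s}. {l. length l = n \<and> sum_list l = r - s} \<times>
      {l. length l = n \<and> sum_list l = s div 2} \<times>
      {l. length l = n \<and> sum_list l = N - (r - s div 2)})"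
    using bij_betw_rows[OF assms] by (rule bij_betw_same_card)
  also have "\<dots> = tcount n N r"
    by (subst card_SigmaI) (auto simp: fin card card_cartesian_product tcount_def mult.assoc)
  finally show ?thesis .
qed

text \<open>All weights are even here, so only weight 0, that is r = N, contributes.\<close>

lemma dim_semi_invariants_quadratic:
  "mpol.dim (homog_part m (semi_invariants (replicate n 2)) :: 'k::field_char_0 mpol set) = tcount n m m"
proof -
  have "wmonos (replicate n 2) m {0, 1} = wmonos (replicate n 2) m {2 * (int m - int m)}"
    by (auto simp: wmonos_def weight_quadratic) presburger
  then show ?thesis
    using card_wmonos_quadratic[of m m n] by (simp add: dim_semi_invariants)
qed

text \<open>Weight 2 corresponds to r = m - 1. The case m = 0 is separate, since truncation would
  turn m - 1 into r = 0, which is weight 0.\<close>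

lemma dim_invariants_quadratic:
  "mpol.dim (homog_part m (invariants (replicate n 2)) :: 'k::field_char_0 mpol set) +
    (if m = 0 then 0 else tcount n m (m - 1)) = tcount n m m"
proof -
  have "card (wmonos (replicate n 2) m {2}) = (if m = 0 then 0 else tcount n m (m - 1))"
  proof (cases m)
    case 0
    have "wmonos (replicate n 2) m {2} = {}"
    proof (rule equals0I)
      fix p assume "p \<in> wmonos (replicate n 2) m {2}"
      then have "mdeg p = 0" and w: "weight (replicate n 2) p = 2"
        using 0 by (auto simp: wmonos_def)
      then have "p = 0"
        by (intro poly_mapping_eqI) (auto simp: mdeg_def in_keys_iff)
      then show False
        using w by (simp add: weight_def grading_def)
    qed
    then show ?thesis
      using 0 by simp
  next
    case (Suc l)
    then show ?thesis
      using card_wmonos_quadratic[of l m n] by simp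
  qed
  then show ?thesis
    using dim_invariants[of m "replicate n 2", where 'k = 'k] card_wmonos_quadratic[of m m n]
    by simp
qed

theorem theorem4p2:
  fixes n :: nat
  assumes "n \<ge> 1"
  shows
    "poincare_series (invariants (replicate n 2) :: 'k::field_char_0 mpol set) =
      (\<Sum>k=1..n. fps_const ((-1) ^ (n - k) / (fact (n - k) * fact (k - 1))) *
        (fps_deriv ^^ (k - 1))
          (\<Sum>i=0..n - k.
            of_nat ((n - k) choose i) *
            fps_const (pochhammer (of_nat n) i * pochhammer (of_nat n) (n - k - i)) *
            (1 - fps_X) * fps_X ^ (2 * n - k - i - 1) /
            ((1 - fps_X) ^ (n + i) * (1 - fps_X ^ 2) ^ (2 * n - k - i))))
     \<and>
     poincare_series (semi_invariants (replicate n 2) :: 'k mpol set) =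
      (\<Sum>k=1..n. fps_const ((-1) ^ (n - k) / (fact (n - k) * fact (k - 1))) *
        (fps_deriv ^^ (k - 1))
          (\<Sum>i=0..n - k.
            of_nat ((n - k) choose i) *
            fps_const (pochhammer (of_nat n) i * pochhammer (of_nat n) (n - k - i)) *
            fps_X ^ (2 * n - k - i - 1) /
            ((1 - fps_X) ^ (n + i) * (1 - fps_X ^ 2) ^ (2 * n - k - i))))"
proof (intro conjI fps_ext)
  fix m
  let ?e = "\<lambda>k. (- 1) ^ (n - k) * of_nat ((m + k - 1) choose (k - 1)) :: rat"
  \<comment> \<open>The factor 1 - z takes differences of adjacent coefficients in z while
    \<open>m\<close> stays fixed in \<open>?e\<close>; this matches the difference of the counts for
    weights 0 and 2.\<close>
  have "(\<Sum>k=1..n. ?e k * ((1 - fps_X) * taylor_series n (n - k)) $ m) =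
      (\<Sum>k=1..n. ?e k * taylor_series n (n - k) $ m) -
      (if m = 0 then 0 else (\<Sum>k=1..n. ?e k * taylor_series n (n - k) $ (m - 1)))"
    by (simp add: left_diff_distrib right_diff_distrib sum_subtractf)
  also have "\<dots> = of_nat (tcount n m m) - (if m = 0 then 0 else of_nat (tcount n m (m - 1)))"
    using taylor_series_sum[OF assms, of m m] taylor_series_sum[OF assms, of "m - 1" m] by simp
  also have "\<dots> = of_nat (mpol.dim (homog_part m (invariants (replicate n 2)) :: 'k mpol set))"
    unfolding dim_invariants_quadratic[where 'k = 'k, symmetric] by simp
  finally show "poincare_series (invariants (replicate n 2) :: 'k mpol set) $ m =
      (\<Sum>k=1..n. fps_const ((-1) ^ (n - k) / (fact (n - k) * fact (k - 1))) *
        (fps_deriv ^^ (k - 1))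
          (\<Sum>i=0..n - k.
            of_nat ((n - k) choose i) *
            fps_const (pochhammer (of_nat n) i * pochhammer (of_nat n) (n - k - i)) *
            (1 - fps_X) * fps_X ^ (2 * n - k - i - 1) /
            ((1 - fps_X) ^ (n + i) * (1 - fps_X ^ 2) ^ (2 * n - k - i)))) $ m"
    unfolding formula_nth[OF assms] by (simp add: poincare_series_def)
next
  fix m
  show "poincare_series (semi_invariants (replicate n 2) :: 'k mpol set) $ m =
      (\<Sum>k=1..n. fps_const ((-1) ^ (n - k) / (fact (n - k) * fact (k - 1))) *
        (fps_deriv ^^ (k - 1))
          (\<Sum>i=0..n - k.
            of_nat ((n - k) choose i) *
            fps_const (pochhammer (of_nat n) i * pochhammer (of_nat n) (n - k - i)) *
            fps_X ^ (2 * n - k - i - 1) /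
            ((1 - fps_X) ^ (n + i) * (1 - fps_X ^ 2) ^ (2 * n - k - i)))) $ m"
    \<comment> \<open>Here \<open>q = 1\<close>, and r = m selects weight 0.\<close>
    using formula_nth[OF assms, of 1 m] taylor_series_sum[OF assms, of m m]
    by (simp only: mult_1_right mult_1_left order_refl poincare_series_def fps_nth_Abs_fps
        dim_semi_invariants_quadratic simp_thms)
qed

end
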